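(* Let $\hbar,c,m,\beta>0$ and $\gamma\geqslant 0$. If $$\gamma\leqslant\gamma_{\rm c}^{\mathcal H}:=\left(\frac{2(2\pi)^{3/2}e^{1/2}}{[\Gamma(1/4)]^4}\right)\hbar c\beta ,$$ then the quadratic form $$\langle\psi,\boldsymbol{\mathcal B}_{\rm FW}\psi\rangle=\Bigl\langle\psi,\sqrt{-\hbar^2c^2\Delta+m^2c^4}\,\psi\Bigr\rangle-\gamma\,\langle\psi,K_0(\beta|\boldsymbol x|)\psi\rangle ,\qquad \psi\in H^{1/2}(\mathbb R^2;\mathbb C),$$ is bounded from below; more precisely, $\langle\psi,\boldsymbol{\mathcal B}_{\rm FW}\psi\rangle\geqslant 0$ for all $\psi\in H^{1/2}(\mathbb R^2;\mathbb C)$.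
   Context: $K_0$ is the modified Bessel function of the second kind (Bessel-Macdonald function) of order $0$ and $\Gamma$ is the Gamma function. The Fourier transform is $\widehat\psi(\boldsymbol p)=\int_{\mathbb R^2}e^{i\hbar^{-1}\boldsymbol p\cdot\boldsymbol x}\psi(\boldsymbol x)\,d\boldsymbol x$. The form of $\sqrt{-\hbar^2c^2\Delta+m^2c^4}$ is $\langle\psi,\sqrt{-\hbar^2c^2\Delta+m^2c^4}\,\psi\rangle=(2\pi\hbar)^{-2}\int_{\mathbb R^2}\sqrt{c^2|\boldsymbol p|^2+m^2c^4}\,|\widehat\psi(\boldsymbol p)|^2\,d\boldsymbol p$ on $H^{1/2}(\mathbb R^2;\mathbb C)$, and $\langle\psi,K_0(\beta|\boldsymbol x|)\psi\rangle=\int_{\mathbb R^2}K_0(\beta|\boldsymbol x|)|\psi(\boldsymbol x)|^2\,d\boldsymbol x$. *)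

theory Defs
  imports "HOL-Analysis.Analysis"
begin

text \<open>Macdonald function for real order and positive argument, by its integral
  representation (DLMF 10.32.9). For \<open>x \<le> 0\<close> the integral diverges and the value is the
  junk value 0; below this only concerns the single point \<open>x = 0\<close> of the plane.\<close>

definition bessel_K :: "real \<Rightarrow> real \<Rightarrow> real" where
  "bessel_K \<nu> x = (LINT t:{0..}|lborel. exp (- x * cosh t) * cosh (\<nu> * t))"

definition fourier_integral :: "real \<Rightarrow> (real^2 \<Rightarrow> complex) \<Rightarrow> real^2 \<Rightarrow> complex" where
  "fourier_integral hbar \<psi> p =
     (LINT x|lebesgue. exp (\<i> * complex_of_real ((p \<bullet> x) / hbar)) * \<psi> x)"

definition L2 :: "(real^2 \<Rightarrow> complex) set" where
  "L2 = {\<psi> \<in> borel_measurable lebesgue. integrable lebesgue (\<lambda>x. (cmod (\<psi> x))\<^sup>2)}"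

text \<open>An \<open>L\<^sup>2\<close> function need not be integrable, so its transform is the Plancherel extension
  of \<^const>\<open>fourier_integral\<close>: the limit in mean square of the transforms of the truncations
  of \<open>\<psi>\<close> to balls (which are integrable). It is determined up to null sets.\<close>

definition is_fourier_transform ::
    "real \<Rightarrow> (real^2 \<Rightarrow> complex) \<Rightarrow> (real^2 \<Rightarrow> complex) \<Rightarrow> bool" where
  "is_fourier_transform hbar \<psi> \<phi> \<longleftrightarrow> \<phi> \<in> L2 \<and>
     ((\<lambda>R::real. \<integral>\<^sup>+ p. ennreal ((cmod (\<phi> p -
          fourier_integral hbar (\<lambda>x. indicator (cball 0 R) x *\<^sub>R \<psi> x) p))\<^sup>2) \<partial>lebesgue)
        \<longlongrightarrow> 0) at_top"

definition fourier_transform :: "real \<Rightarrow> (real^2 \<Rightarrow> complex) \<Rightarrow> real^2 \<Rightarrow> complex" where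
  "fourier_transform hbar \<psi> = (SOME \<phi>. is_fourier_transform hbar \<psi> \<phi>)"

text \<open>The Sobolev space \<open>H\<^sup>1\<^sup>/\<^sup>2\<close> of the plane, elements given by representatives.
  It does not depend on \<open>\<hbar>\<close>.\<close>

definition H_half :: "(real^2 \<Rightarrow> complex) set" where
  "H_half = {\<psi> \<in> L2. \<exists>\<phi>. is_fourier_transform 1 \<psi> \<phi> \<and>
     integrable lebesgue (\<lambda>p. sqrt (1 + (norm p)\<^sup>2) * (cmod (\<phi> p))\<^sup>2)}"

definition kinetic_density ::
    "real \<Rightarrow> real \<Rightarrow> real \<Rightarrow> (real^2 \<Rightarrow> complex) \<Rightarrow> real^2 \<Rightarrow> real" where
  "kinetic_density hbar c m \<psi> p =
     sqrt (c\<^sup>2 * (norm p)\<^sup>2 + m\<^sup>2 * c^4) * (cmod (fourier_transform hbar \<psi> p))\<^sup>2"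

definition kinetic_form :: "real \<Rightarrow> real \<Rightarrow> real \<Rightarrow> (real^2 \<Rightarrow> complex) \<Rightarrow> real" where
  "kinetic_form hbar c m \<psi> =
     1 / (2 * pi * hbar)\<^sup>2 * (LINT p|lebesgue. kinetic_density hbar c m \<psi> p)"

definition potential_density :: "real \<Rightarrow> (real^2 \<Rightarrow> complex) \<Rightarrow> real^2 \<Rightarrow> real" where
  "potential_density \<beta> \<psi> x = bessel_K 0 (\<beta> * norm x) * (cmod (\<psi> x))\<^sup>2"

definition potential_form :: "real \<Rightarrow> (real^2 \<Rightarrow> complex) \<Rightarrow> real" where
  "potential_form \<beta> \<psi> = (LINT x|lebesgue. potential_density \<beta> \<psi> x)"

definition B_FW_form ::
    "real \<Rightarrow> real \<Rightarrow> real \<Rightarrow> real \<Rightarrow> real \<Rightarrow> (real^2 \<Rightarrow> complex) \<Rightarrow> real" where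
  "B_FW_form hbar c m \<beta> \<gamma> \<psi> = kinetic_form hbar c m \<psi> - \<gamma> * potential_form \<beta> \<psi>"

definition gamma_crit :: "real \<Rightarrow> real \<Rightarrow> real \<Rightarrow> real" where
  "gamma_crit hbar c \<beta> =
     (2 * (2 * pi) powr (3/2) * exp (1/2) / (Gamma (1/4 :: real))^4) * hbar * c * \<beta>"

end

theory Submission
  imports Defs "HOL-Probability.Probability" "HOL-Real_Asymp.Real_Asymp"
begin

text \<open>
  Idea. A translation of the integration variable turns \<open>K\<^sub>0(\<beta>|x|)\<close> into a mixture of Gaussians
  \<open>exp (- a |x|\<^sup>2)\<close>. For a single Gaussian weight,
  \<open>(2\<pi>)\<^sup>4 \<integral> exp (- a |x|\<^sup>2) |\<psi>|\<^sup>2 \<le> \<integral>\<integral> |\<phi>(p)| |\<phi>(q)| (\<pi>/a) exp (- |p - q|\<^sup>2 / (4 a)) dp dq\<close>,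
  where \<open>\<phi>\<close> is the Fourier transform of \<open>\<psi>\<close>. Integrating over the mixture replaces the kernel by
  \<open>2\<pi> / (|p - q|\<^sup>2 + \<beta>\<^sup>2)\<close>. The Schur test with weight \<open>1/|p|\<close> and
  \<open>\<integral> dq / (|q| (|p - q|\<^sup>2 + \<beta>\<^sup>2)) \<le> \<integral> dq / (|q| (|q|\<^sup>2 + \<beta>\<^sup>2)) = \<pi>\<^sup>2/\<beta>\<close>
  then give \<open>\<integral> K\<^sub>0(\<beta>|x|) |\<psi>|\<^sup>2 \<le> (8\<pi>\<beta>)\<^sup>-\<^sup>1 \<integral> |p| |\<phi>|\<^sup>2\<close>, so the form is nonnegative as soon as
  \<open>\<gamma> \<le> 2\<hbar>c\<beta>/\<pi>\<close>. The critical coupling of the theorem is smaller, because \<open>\<Gamma>(1/4) \<ge> 16/5\<close>.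
\<close>

section \<open>Gaussian integrals\<close>

text \<open>The obstacle is that an element of \<open>H_half\<close> comes with a transform
  \<open>\<phi>\<close> that is only square-integrable, a limit in mean square. For an integrable
  \<open>\<phi>\<close> the single-Gaussian inequality is Fubini plus the triangle inequality. So
  \<open>\<phi>\<close> is damped by a Gaussian of rate \<open>\<epsilon>\<close>. On the side of
  \<open>\<psi>\<close> this is convolution with a heat kernel, and since damping lowers
  \<open>cmod (\<phi> p)\<close> the bound is uniform in \<open>\<epsilon>\<close>. The limit is
  then taken by duality. Phases are discarded once the Gaussian integral in position space is done.
  From there on every kernel is nonnegative, so the mixture may be exchanged with the momentum
  integrals freely. The Schur weight 1/|p| returns |p| |phi|^2, the massless kinetic density, which
  bounds the massive one from below. In the variable k = p/hbar the kinetic form is at least hbar c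
  / (4 pi^2) times its integral. The potential side has the factor 2 pi (pi^2/beta) / (2 pi)^4 =
  1/(8 pi beta). The quotient of the two is the threshold 2 hbar c beta / pi.\<close>

lemma gaussian_fourier_real:
  fixes a k :: real
  assumes a: "a > 0"
  shows "integrable lborel (\<lambda>x::real. exp (- a * x\<^sup>2))"
    and "(LINT x|lborel. iexp (k * x) * complex_of_real (exp (- a * x\<^sup>2)))
           = complex_of_real (sqrt (pi / a) * exp (- k\<^sup>2 / (4 * a)))"
proof -
  \<comment> \<open>At this scale \<open>exp (- a * (c * x)\<^sup>2)\<close> is
    \<open>sqrt (2 * pi)\<close> times the standard normal density, so the transform becomes its
    characteristic function.\<close>
  define c where "c = 1 / sqrt (2 * a)"
  have c: "c > 0" "c\<^sup>2 = 1 / (2 * a)" using a by (auto simp: c_def power_divide)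
  have sc: "std_normal_density x = exp (- a * (c * x)\<^sup>2) / sqrt (2 * pi)" for x
    using a c by (simp add: std_normal_density_def power_mult_distrib)
  have "integrable lborel (\<lambda>x. sqrt (2 * pi) * std_normal_density x)"
    by (intro integrable_mult_right integrable_normal_density) simp
  then have "integrable lborel (\<lambda>x. exp (- a * (0 + c * x)\<^sup>2))"
    by (simp add: sc)
  then show "integrable lborel (\<lambda>x::real. exp (- a * x\<^sup>2))"
    using lborel_integrable_real_affine_iff[of c "\<lambda>x. exp (- a * x\<^sup>2)" 0] c by simp
  have "(LINT x|lborel. iexp (k * x) * complex_of_real (exp (- a * x\<^sup>2)))
      = \<bar>c\<bar> *\<^sub>R (LINT x|lborel. iexp (k * (0 + c * x)) * complex_of_real (exp (- a * (0 + c * x)\<^sup>2)))"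
    using c by (intro lborel_integral_real_affine) auto
  also have "(LINT x|lborel. iexp (k * (0 + c * x)) * complex_of_real (exp (- a * (0 + c * x)\<^sup>2)))
      = (LINT x|lborel. sqrt (2 * pi) *\<^sub>R (std_normal_density x *\<^sub>R iexp ((k * c) * x)))"
    by (intro Bochner_Integration.integral_cong) (auto simp: sc scaleR_conv_of_real mult_ac)
  also have "\<dots> = sqrt (2 * pi) *\<^sub>R char std_normal_distribution (k * c)"
    unfolding char_def by (subst integral_density) (auto simp: normal_density_nonneg simp flip: integral_scaleR_right)
  also have "\<dots> = sqrt (2 * pi) *\<^sub>R complex_of_real (exp (- (k * c)\<^sup>2 / 2))"
    by (simp add: char_std_normal_distribution)
  also have "\<bar>c\<bar> *\<^sub>R \<dots> = complex_of_real ((c * sqrt (2 * pi)) * exp (- (k * c)\<^sup>2 / 2))"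
    using c by (simp add: scaleR_conv_of_real)
  also have "c * sqrt (2 * pi) = sqrt (pi / a)"
    using a by (simp add: c_def real_sqrt_mult real_sqrt_divide)
  also have "- (k * c)\<^sup>2 / 2 = - k\<^sup>2 / (4 * a)"
    using c by (simp add: power_mult_distrib)
  finally show "(LINT x|lborel. iexp (k * x) * complex_of_real (exp (- a * x\<^sup>2)))
           = complex_of_real (sqrt (pi / a) * exp (- k\<^sup>2 / (4 * a)))" by simp
qed

lemma norm_sq_eq_sum_Basis: "(norm (x::'a::euclidean_space))\<^sup>2 = (\<Sum>b\<in>Basis. (x \<bullet> b)\<^sup>2)"
  by (subst norm_eq_sqrt_inner, subst euclidean_inner)
     (simp add: power2_eq_square sum_nonneg)

text \<open>\<open>lborel\<close> is the image of the product of one-dimensional Lebesgue measures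
  under the sum of coordinates, which reduces the claim to Fubini for finite products. It carries
  the one-dimensional Gaussian transform over to any dimension.\<close>

lemma integral_lborel_prod:
  fixes f :: "'a::euclidean_space \<Rightarrow> real \<Rightarrow> complex"
  assumes f: "\<And>b. b \<in> Basis \<Longrightarrow> integrable lborel (f b)"
  shows "(LINT x|lborel. (\<Prod>b\<in>Basis. f b (x \<bullet> b))) = (\<Prod>b\<in>Basis. LINT t|lborel. f b t)"
proof -
  interpret product_sigma_finite "\<lambda>b::'a. lborel::real measure" ..
  have [measurable]: "f b \<in> borel_measurable borel" if "b \<in> Basis" for b
    using f[OF that] by auto
  have "(LINT x|lborel. (\<Prod>b\<in>Basis. f b (x \<bullet> b)))
      = (LINT x|distr (\<Pi>\<^sub>M b\<in>(Basis::'a set). lborel) borel (\<lambda>f. \<Sum>b\<in>Basis. f b *\<^sub>R b).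
           (\<Prod>b\<in>Basis. f b (x \<bullet> b)))"
    by (subst lborel_eq) simp
  also have "\<dots> = (LINT x|(\<Pi>\<^sub>M b\<in>(Basis::'a set). lborel). (\<Prod>b\<in>Basis. f b (x b)))"
    by (subst integral_distr) (auto intro!: Bochner_Integration.integral_cong prod.cong)
  also have "\<dots> = (\<Prod>b\<in>Basis. LINT t|lborel. f b t)"
    using f by (intro product_integral_prod) auto
  finally show ?thesis .
qed

lemma integrable_gaussian:
  assumes a: "a > 0"
  shows "integrable lborel (\<lambda>x::'a::euclidean_space. exp (- a * (norm x)\<^sup>2))"
proof (rule integrableI_nonneg)
  have "(\<integral>\<^sup>+ x. ennreal (exp (- a * (norm (x::'a))\<^sup>2)) \<partial>lborel)
      = (\<integral>\<^sup>+ x. (\<Prod>b\<in>Basis. ennreal (exp (- a * ((x::'a) \<bullet> b)\<^sup>2))) \<partial>lborel)"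
    by (intro nn_integral_cong)
       (simp add: norm_sq_eq_sum_Basis sum_distrib_left exp_sum prod_ennreal flip: sum_negf)
  also have "\<dots> = (\<Prod>b\<in>(Basis::'a set). \<integral>\<^sup>+ x. ennreal (exp (- a * x\<^sup>2)) \<partial>lborel)"
    by (rule nn_integral_lborel_prod) auto
  also have "\<dots> < \<infinity>"
    using gaussian_fourier_real(1)[OF a]
    by (simp add: nn_integral_eq_integral power_less_top_ennreal)
  finally show "(\<integral>\<^sup>+ x. ennreal (exp (- a * (norm (x::'a))\<^sup>2)) \<partial>lborel) < \<infinity>" .
qed auto

lemma gaussian_fourier:
  fixes p :: "'a::euclidean_space"
  assumes a: "a > 0"
  shows "(LINT x|lborel. iexp (p \<bullet> x) * complex_of_real (exp (- a * (norm x)\<^sup>2)))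
           = complex_of_real (sqrt (pi / a) ^ DIM('a) * exp (- (norm p)\<^sup>2 / (4 * a)))"
proof -
  have "iexp (p \<bullet> x) * complex_of_real (exp (- a * (norm x)\<^sup>2))
      = (\<Prod>b\<in>Basis. iexp ((p \<bullet> b) * (x \<bullet> b)) * complex_of_real (exp (- a * (x \<bullet> b)\<^sup>2)))" for x
  proof -
    have "iexp (p \<bullet> x) = (\<Prod>b\<in>Basis. iexp ((p \<bullet> b) * (x \<bullet> b)))"
      by (subst euclidean_inner) (simp add: sum_distrib_left exp_sum)
    moreover have "exp (- a * (norm x)\<^sup>2) = (\<Prod>b\<in>Basis. exp (- a * (x \<bullet> b)\<^sup>2))"
      by (simp add: norm_sq_eq_sum_Basis sum_distrib_left exp_sum flip: sum_negf)
    ultimately show ?thesis by (simp add: prod.distrib)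
  qed
  then have "(LINT x|lborel. iexp (p \<bullet> x) * complex_of_real (exp (- a * (norm x)\<^sup>2)))
      = (LINT x|lborel. (\<Prod>b\<in>Basis. (\<lambda>t. iexp ((p \<bullet> b) * t) * complex_of_real (exp (- a * t\<^sup>2))) (x \<bullet> b)))"
    by simp
  also have "\<dots> = (\<Prod>b\<in>Basis. LINT t|lborel. iexp ((p \<bullet> b) * t) * complex_of_real (exp (- a * t\<^sup>2)))"
  proof (rule integral_lborel_prod)
    fix b :: 'a
    show "integrable lborel (\<lambda>t. iexp ((p \<bullet> b) * t) * complex_of_real (exp (- a * t\<^sup>2)))"
      by (rule Bochner_Integration.integrable_bound[OF gaussian_fourier_real(1)[OF a]])
         (auto simp: norm_mult)
  qed
  also have "\<dots> = (\<Prod>b\<in>Basis. complex_of_real (sqrt (pi / a) * exp (- (p \<bullet> b)\<^sup>2 / (4 * a))))"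
    by (simp only: gaussian_fourier_real(2)[OF a])
  also have "\<dots> = complex_of_real (sqrt (pi / a) ^ DIM('a) * exp (- (norm p)\<^sup>2 / (4 * a)))"
    by (simp add: prod.distrib norm_sq_eq_sum_Basis sum_divide_distrib exp_sum flip: sum_negf)
  finally show ?thesis .
qed

lemma integral_gaussian:
  assumes a: "a > 0"
  shows "(LINT x|lborel. exp (- a * (norm (x::'a::euclidean_space))\<^sup>2)) = sqrt (pi / a) ^ DIM('a)"
proof -
  have "complex_of_real (LINT x|lborel. exp (- a * (norm (x::'a))\<^sup>2))
      = (LINT x|lborel. iexp (0 \<bullet> x) * complex_of_real (exp (- a * (norm (x::'a))\<^sup>2)))"
    by simp
  also have "\<dots> = complex_of_real (sqrt (pi / a) ^ DIM('a))"
    by (subst gaussian_fourier[OF a]) simp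
  finally show ?thesis by (simp only: of_real_eq_iff)
qed

section \<open>Gaussian-weighted norms in Fourier space\<close>

lemma integrable_lborel_pair_mult:
  fixes f :: "'a::euclidean_space \<Rightarrow> 'c::{real_normed_field,banach,second_countable_topology}"
    and g :: "'b::euclidean_space \<Rightarrow> 'c"
  assumes f: "integrable lborel f" and g: "integrable lborel g"
  shows "integrable (lborel \<Otimes>\<^sub>M lborel) (\<lambda>s. f (fst s) * g (snd s))"
proof (rule lborel_pair.Fubini_integrable)
  have [measurable]: "f \<in> borel_measurable borel" "g \<in> borel_measurable borel"
    using f g by auto
  show "(\<lambda>s. f (fst s) * g (snd s)) \<in> borel_measurable (lborel \<Otimes>\<^sub>M lborel)"
    by measurable
  show "integrable lborel (\<lambda>x. LINT y|lborel. norm (f (fst (x, y)) * g (snd (x, y))))"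
    using f g by (simp add: norm_mult)
  show "AE x in lborel. integrable lborel (\<lambda>y. f (fst (x, y)) * g (snd (x, y)))"
    using g by simp
qed

text \<open>The Fourier transform of the Gaussian of rate \<open>a\<close>, in the convention with
  kernel \<open>iexp (p \<bullet> x)\<close>. It has two roles: a kernel in \<open>p - q\<close> in
  momentum space, and a mollifier in position space, where it has total mass (2 pi)^d for every
  \<open>a\<close> and concentrates at the origin as \<open>a\<close> tends to 0.\<close>

definition gauss_hat :: "real \<Rightarrow> 'a::euclidean_space \<Rightarrow> real" where
  "gauss_hat a w = sqrt (pi / a) ^ DIM('a) * exp (- (norm w)\<^sup>2 / (4 * a))"

lemma gauss_hat_measurable [measurable]: "gauss_hat a \<in> borel_measurable borel"
  unfolding gauss_hat_def by measurable

lemma gauss_hat_nonneg [simp]: "a > 0 \<Longrightarrow> 0 \<le> gauss_hat a w"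
  by (simp add: gauss_hat_def)

lemma gauss_hat_le: "a > 0 \<Longrightarrow> gauss_hat a (w::'a::euclidean_space) \<le> sqrt (pi / a) ^ DIM('a)"
  unfolding gauss_hat_def by (rule mult_left_le) auto

lemma gauss_hat_uminus [simp]: "gauss_hat a (- w) = gauss_hat a w"
  by (simp add: gauss_hat_def)

lemma fourier_gauss_hat:
  assumes "a > 0"
  shows "(LINT x|lborel. iexp (p \<bullet> x) * complex_of_real (exp (- a * (norm x)\<^sup>2)))
           = complex_of_real (gauss_hat a p)"
  using gaussian_fourier[OF assms, of p] by (simp add: gauss_hat_def)

text \<open>Expanding the square gives a double integral over \<open>p\<close> and \<open>q\<close>.
  Integrating in \<open>z\<close> first turns the Gaussian weight into
  \<open>gauss_hat a (p - q)\<close>, and the triangle inequality then removes the phases.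
  Integrability of \<open>\<kappa>\<close> is what allows the exchange.\<close>

lemma gaussian_weighted_bound:
  fixes \<kappa> :: "'a::euclidean_space \<Rightarrow> complex"
  assumes \<kappa>: "integrable lborel \<kappa>" and a: "a > 0"
  defines "k \<equiv> \<lambda>z. LINT p|lborel. \<kappa> p * iexp (- (p \<bullet> z))"
  shows "(\<integral>\<^sup>+z. ennreal (exp (- a * (norm z)\<^sup>2) * (cmod (k z))\<^sup>2) \<partial>lborel)
     \<le> (\<integral>\<^sup>+p. \<integral>\<^sup>+q. ennreal (cmod (\<kappa> p) * cmod (\<kappa> q) * gauss_hat a (p - q)) \<partial>lborel \<partial>lborel)"
proof -
  define V where "V z = exp (- a * (norm z)\<^sup>2)" for z :: 'a
  define K where "K s = \<kappa> (fst s) * cnj (\<kappa> (snd s))" for s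
  define E where "E w = iexp (- (w :: real))" for w
  have [measurable]: "\<kappa> \<in> borel_measurable borel" using \<kappa> by auto
  have [measurable]: "V \<in> borel_measurable borel" "E \<in> borel_measurable borel"
    unfolding V_def E_def by measurable
  have [measurable]: "k \<in> borel_measurable borel" unfolding k_def by measurable
  have [measurable]: "(\<lambda>s. fst s) \<in> borel_measurable (borel :: ('a \<times> 'a) measure)"
      "(\<lambda>s. snd s) \<in> borel_measurable (borel :: ('a \<times> 'a) measure)"
    by (auto intro!: borel_measurable_continuous_onI continuous_intros)
  have E1: "cmod (E w) = 1" for w by (simp add: E_def)
  have V: "integrable lborel V" unfolding V_def by (rule integrable_gaussian[OF a])
  have V0: "V z \<ge> 0" for z by (simp add: V_def)
  have K: "integrable lborel K"
    using integrable_lborel_pair_mult[OF \<kappa>, of "\<lambda>q. cnj (\<kappa> q)"] \<kappa>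
    by (simp add: K_def[abs_def] lborel_prod)
  have [measurable]: "K \<in> borel_measurable borel" using K by auto
  have kk: "complex_of_real ((cmod (k z))\<^sup>2) = (LINT s|lborel. K s * E ((fst s - snd s) \<bullet> z))" for z
  proof -
    have "complex_of_real ((cmod (k z))\<^sup>2) = k z * cnj (k z)"
      by (simp add: complex_norm_square[symmetric])
    also have "\<dots> = (LINT p|lborel. \<kappa> p * E (p \<bullet> z)) * (LINT q|lborel. cnj (\<kappa> q * E (q \<bullet> z)))"
      by (simp only: k_def E_def Bochner_Integration.integral_cnj)
    also have "\<dots> = (LINT p|lborel. LINT q|lborel. (\<kappa> p * E (p \<bullet> z)) * cnj (\<kappa> q * E (q \<bullet> z)))"
      by simp
    also have "\<dots> = (LINT p|lborel. LINT q|lborel. (\<lambda>s. K s * E ((fst s - snd s) \<bullet> z)) (p, q))"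
      by (simp add: K_def E_def inner_diff_left exp_diff exp_minus field_simps exp_cnj
          flip: exp_add)
    also have "\<dots> = (LINT s|(lborel \<Otimes>\<^sub>M lborel). K s * E ((fst s - snd s) \<bullet> z))"
    proof (rule lborel_pair.integral_fst')
      show "integrable (lborel \<Otimes>\<^sub>M lborel) (\<lambda>s. K s * E ((fst s - snd s) \<bullet> z))"
        unfolding lborel_prod
        by (rule Bochner_Integration.integrable_bound[OF K]) (auto simp: norm_mult E1)
    qed
    finally show ?thesis by (simp add: lborel_prod)
  qed
  \<comment> \<open>\<open>K\<close> is integrable in \<open>s\<close> and the Gaussian in
    \<open>z\<close>, while the phase has modulus 1; this is the joint majorant for Fubini.\<close>
  have int3: "integrable (lborel \<Otimes>\<^sub>M lborel)
      (\<lambda>(z, s). complex_of_real (V z) * K s * E ((fst s - snd s) \<bullet> z))"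
    by (rule Bochner_Integration.integrable_bound[OF integrable_lborel_pair_mult[OF _ K, of "\<lambda>z. complex_of_real (V z)"]])
       (use V in \<open>auto simp: norm_mult E1\<close>)
  have kbound: "cmod (k z) \<le> (LINT p|lborel. cmod (\<kappa> p))" for z
    unfolding k_def by (rule order_trans[OF integral_norm_bound]) (simp add: norm_mult)
  have intL: "integrable lborel (\<lambda>z. V z * (cmod (k z))\<^sup>2)"
    by (rule Bochner_Integration.integrable_bound[OF integrable_mult_left[OF V, of "(LINT p|lborel. cmod (\<kappa> p))\<^sup>2"]])
       (use kbound V0 in \<open>auto intro!: mult_left_mono power_mono simp: abs_mult\<close>)
  have "complex_of_real (LINT z|lborel. V z * (cmod (k z))\<^sup>2)
      = (LINT z|lborel. complex_of_real (V z) * complex_of_real ((cmod (k z))\<^sup>2))"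
    by (simp flip: integral_complex_of_real)
  also have "\<dots> = (LINT z|lborel. LINT s|lborel. complex_of_real (V z) * K s * E ((fst s - snd s) \<bullet> z))"
    unfolding kk by (simp add: mult.assoc)
  also have "\<dots> = (LINT s|lborel. LINT z|lborel. complex_of_real (V z) * K s * E ((fst s - snd s) \<bullet> z))"
    using lborel_pair.Fubini_integral[OF int3] by simp
  also have "\<dots> = (LINT s|lborel. K s * complex_of_real (gauss_hat a (fst s - snd s)))"
  proof (intro Bochner_Integration.integral_cong refl)
    fix s :: "'a \<times> 'a"
    have "(LINT z|lborel. complex_of_real (V z) * K s * E ((fst s - snd s) \<bullet> z))
        = (LINT z|lborel. K s * (iexp (- (fst s - snd s) \<bullet> z) * complex_of_real (exp (- a * (norm z)\<^sup>2))))"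
      by (intro Bochner_Integration.integral_cong) (auto simp: V_def E_def mult_ac inner_diff_left)
    also have "\<dots> = K s * complex_of_real (gauss_hat a (- (fst s - snd s)))"
      unfolding integral_mult_right_zero by (subst fourier_gauss_hat[OF a]) (rule refl)
    finally show "(LINT z|lborel. complex_of_real (V z) * K s * E ((fst s - snd s) \<bullet> z))
        = K s * complex_of_real (gauss_hat a (fst s - snd s))" by (simp only: gauss_hat_uminus)
  qed
  finally have eq: "complex_of_real (LINT z|lborel. V z * (cmod (k z))\<^sup>2)
      = (LINT s|lborel. K s * complex_of_real (gauss_hat a (fst s - snd s)))" .
  have intKG: "integrable lborel (\<lambda>s. cmod (K s) * gauss_hat a (fst s - snd s))"
    by (rule Bochner_Integration.integrable_bound[OF integrable_mult_left[OF integrable_norm[OF K], of "sqrt (pi / a) ^ DIM('a)"]])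
       (use a in \<open>auto simp: abs_mult intro!: mult_left_mono gauss_hat_le\<close>)
  have "(\<integral>\<^sup>+z. ennreal (V z * (cmod (k z))\<^sup>2) \<partial>lborel)
      = ennreal (LINT z|lborel. V z * (cmod (k z))\<^sup>2)"
    using V0 intL by (intro nn_integral_eq_integral) auto
  also have "(LINT z|lborel. V z * (cmod (k z))\<^sup>2)
      \<le> cmod (complex_of_real (LINT z|lborel. V z * (cmod (k z))\<^sup>2))"
    by simp
  also have "\<dots> \<le> (LINT s|lborel. cmod (K s) * gauss_hat a (fst s - snd s))"
    unfolding eq by (rule order_trans[OF integral_norm_bound]) (use a in \<open>simp add: norm_mult\<close>)
  also have "ennreal \<dots> = (\<integral>\<^sup>+s. ennreal (cmod (K s) * gauss_hat a (fst s - snd s)) \<partial>lborel)"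
    using intKG a by (intro nn_integral_eq_integral[symmetric]) auto
  also have "\<dots> = (\<integral>\<^sup>+p. \<integral>\<^sup>+q. ennreal (cmod (\<kappa> p) * cmod (\<kappa> q) * gauss_hat a (p - q)) \<partial>lborel \<partial>lborel)"
    by (subst lborel_prod[symmetric], subst lborel.nn_integral_fst[symmetric])
       (auto simp: K_def norm_mult)
  finally show ?thesis by (simp add: V_def ennreal_leI)
qed

text \<open>Both sides are iterated integrals of one integrable function of two variables. The
  formula moves the transform from a truncated \<open>\<psi>\<close> to an explicit
  Gaussian.\<close>

lemma fourier_multiplication_formula:
  fixes f :: "'a::euclidean_space \<Rightarrow> complex" and \<eta> :: "'a \<Rightarrow> complex"
  assumes f: "integrable lborel f" and \<eta>: "integrable lborel \<eta>"
  shows "(LINT p|lborel. (LINT x|lborel. iexp (p \<bullet> x) * f x) * \<eta> p)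
       = (LINT x|lborel. f x * (LINT p|lborel. iexp (p \<bullet> x) * \<eta> p))"
proof -
  have [measurable]: "f \<in> borel_measurable borel" "\<eta> \<in> borel_measurable borel"
    using f \<eta> by auto
  have "integrable (lborel \<Otimes>\<^sub>M lborel) (\<lambda>(x, p). f x * \<eta> p * iexp (p \<bullet> x))"
    by (rule Bochner_Integration.integrable_bound[OF integrable_lborel_pair_mult[OF f \<eta>]])
       (auto simp: norm_mult)
  from lborel_pair.Fubini_integral[OF this]
  have "(LINT p|lborel. LINT x|lborel. f x * \<eta> p * iexp (p \<bullet> x))
      = (LINT x|lborel. LINT p|lborel. f x * \<eta> p * iexp (p \<bullet> x))" by simp
  moreover have "(LINT x|lborel. f x * \<eta> p * iexp (p \<bullet> x))
       = (LINT x|lborel. iexp (p \<bullet> x) * f x) * \<eta> p" for p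
    by (subst integral_mult_left_zero[symmetric]) (simp add: mult_ac)
  moreover have "(LINT p|lborel. f x * \<eta> p * iexp (p \<bullet> x))
       = f x * (LINT p|lborel. iexp (p \<bullet> x) * \<eta> p)" for x
    by (subst integral_mult_right_zero[symmetric]) (simp add: mult_ac)
  ultimately show ?thesis by simp
qed

section \<open>Mollification\<close>

lemma integrable_L2_mult_gaussian:
  fixes \<psi> :: "'a::euclidean_space \<Rightarrow> complex"
  assumes [measurable]: "\<psi> \<in> borel_measurable borel"
    and L2: "integrable lborel (\<lambda>x. (cmod (\<psi> x))\<^sup>2)" and b: "b > 0"
  shows "integrable lborel (\<lambda>x. cmod (\<psi> x) * exp (- b * (norm x)\<^sup>2))"
proof (rule Bochner_Integration.integrable_bound)
  show "integrable lborel (\<lambda>x. (cmod (\<psi> x))\<^sup>2 + exp (- (2 * b) * (norm x)\<^sup>2))"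
    using L2 b by (intro Bochner_Integration.integrable_add integrable_gaussian) auto
  have "x * y \<le> x\<^sup>2 + y\<^sup>2" for x y :: real
    using sum_squares_bound[of x y] zero_le_power2[of x] zero_le_power2[of y] by linarith
  moreover have "exp (- (2 * b) * (norm x)\<^sup>2) = (exp (- b * (norm x)\<^sup>2))\<^sup>2" for x :: 'a
    by (simp add: power2_eq_square flip: exp_add)
  ultimately
  show "AE x in lborel. norm (cmod (\<psi> x) * exp (- b * (norm x)\<^sup>2))
      \<le> norm ((cmod (\<psi> x))\<^sup>2 + exp (- (2 * b) * (norm x)\<^sup>2))"
    by (simp only: real_norm_def abs_mult abs_exp_cancel abs_norm_cancel) (intro AE_I2 order_trans[OF _ abs_ge_self], simp)
qed measurable

lemma norm_sq_le_twice_diff: "(norm (x::'a::real_inner))\<^sup>2 \<le> 2 * (norm (x - z))\<^sup>2 + 2 * (norm z)\<^sup>2"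
proof -
  have "norm x \<le> norm (x - z) + norm z" using norm_triangle_sub[of x z] by simp
  then have "(norm x)\<^sup>2 \<le> (norm (x - z) + norm z)\<^sup>2" by (rule power_mono) simp
  also have "\<dots> \<le> 2 * (norm (x - z))\<^sup>2 + 2 * (norm z)\<^sup>2"
    using sum_squares_bound[of "norm (x - z)" "norm z"] by (simp add: power2_sum)
  finally show ?thesis .
qed

text \<open>The substitution z = x - delta y. It moves the dependence on \<open>\<delta>\<close>
  from the kernel into the argument of \<open>f\<close>, so that the kernel stays fixed while
  \<open>\<delta>\<close> tends to 0.\<close>

lemma gauss_hat_shift_scale:
  fixes f :: "'a::euclidean_space \<Rightarrow> complex"
  assumes \<delta>: "\<delta> > 0" and [measurable]: "f \<in> borel_measurable borel"
  shows "(LINT z|lborel. f z * complex_of_real (gauss_hat (\<delta>\<^sup>2) (x - z)))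
       = (LINT y|lborel. f (x - \<delta> *\<^sub>R y) * complex_of_real (gauss_hat 1 y))"
proof -
  define c where "c = sqrt pi ^ DIM('a)"
  have "(LINT z|lborel. f z * complex_of_real (gauss_hat (\<delta>\<^sup>2) (x - z)))
      = (LINT z|density (distr lborel borel (\<lambda>y. x + (- \<delta>) *\<^sub>R y)) (\<lambda>_. \<bar>- \<delta>\<bar>^DIM('a)).
           f z * complex_of_real (gauss_hat (\<delta>\<^sup>2) (x - z)))"
    using lborel_affine[of "- \<delta>" x] \<delta> by simp
  also have "\<dots> = (LINT y|lborel. \<delta> ^ DIM('a) *\<^sub>R (f (x - \<delta> *\<^sub>R y) * complex_of_real (gauss_hat (\<delta>\<^sup>2) (\<delta> *\<^sub>R y))))"
    using \<delta> by (subst integral_density) (auto simp: integral_distr ennreal_power)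
  also have "\<dots> = (LINT y|lborel. f (x - \<delta> *\<^sub>R y) * complex_of_real (gauss_hat 1 y))"
  proof (intro Bochner_Integration.integral_cong refl)
    fix y :: 'a
    have "\<delta> ^ DIM('a) * gauss_hat (\<delta>\<^sup>2) (\<delta> *\<^sub>R y) = gauss_hat 1 y"
      using \<delta> by (simp add: gauss_hat_def real_sqrt_divide power_divide power_mult_distrib)
    from this[symmetric] show "\<delta> ^ DIM('a) *\<^sub>R (f (x - \<delta> *\<^sub>R y) * complex_of_real (gauss_hat (\<delta>\<^sup>2) (\<delta> *\<^sub>R y)))
        = f (x - \<delta> *\<^sub>R y) * complex_of_real (gauss_hat 1 y)"
      by (simp add: scaleR_conv_of_real)
  qed
  finally show ?thesis .
qed

lemma integral_gauss_hat_1: "(LINT y|lborel. gauss_hat 1 (y::'a::euclidean_space)) = (2 * pi) ^ DIM('a)"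
proof -
  have "(LINT y|lborel. gauss_hat 1 (y::'a))
      = (LINT y|lborel. sqrt pi ^ DIM('a) * exp (- (1 / 4) * (norm (y::'a))\<^sup>2))"
    by (simp add: gauss_hat_def)
  also have "\<dots> = sqrt pi ^ DIM('a) * sqrt (pi / (1 / 4)) ^ DIM('a)"
    by (subst integral_mult_right_zero, subst integral_gaussian) auto
  also have "\<dots> = (sqrt pi * sqrt (pi * 4)) ^ DIM('a)" by (simp add: power_mult_distrib)
  also have "sqrt pi * sqrt (pi * 4) = 2 * pi" by (simp add: real_sqrt_mult)
  finally show ?thesis .
qed

text \<open>Fubini moves the mollifier from \<open>\<psi>\<close>, which is merely measurable, to
  the continuous \<open>u\<close>, where u(x - delta y) tends to u(x) at every point and dominated
  convergence applies. The factor (2 pi)^d is the mass of the mollifier.\<close>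

lemma mollification_duality:
  fixes \<psi> u :: "'a::euclidean_space \<Rightarrow> complex"
  assumes [measurable]: "\<psi> \<in> borel_measurable borel"
    and L2: "integrable lborel (\<lambda>x. (cmod (\<psi> x))\<^sup>2)"
    and cont: "continuous_on UNIV u"
    and u: "\<And>x. cmod (u x) \<le> M * exp (- b * (norm x)\<^sup>2)" and b: "0 < b" "b \<le> 1/8"
  shows "(\<lambda>n. LINT z|lborel. u z * (LINT x|lborel. \<psi> x * complex_of_real (gauss_hat ((1 / real (Suc n))\<^sup>2) (x - z))))
           \<longlonglongrightarrow> complex_of_real ((2 * pi) ^ DIM('a)) * (LINT x|lborel. \<psi> x * u x)"
proof -
  have um [measurable]: "u \<in> borel_measurable borel"
    using cont by (rule borel_measurable_continuous_onI)
  have M: "M \<ge> 0"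
    using order_trans[OF norm_ge_zero u[of 0]] by simp
  define d where "d n = 1 / real (Suc n)" for n
  have d: "d n > 0" "d n \<le> 1" for n by (auto simp: d_def)
  define g1 :: "'a \<Rightarrow> real" where "g1 = gauss_hat 1"
  have [measurable]: "g1 \<in> borel_measurable borel" by (simp add: g1_def)
  \<comment> \<open>A majorant independent of \<open>n\<close>. Half of the decay rate
    \<open>b\<close> is passed from x - delta y to x by |x|^2 <= 2 |delta y|^2 + 2 |x - delta y|^2.
    This costs b |y|^2, at most |y|^2 / 8 by the assumption on \<open>b\<close>, so half of the
    exponent |y|^2 / 4 of \<open>g1\<close> survives.\<close>
  define w where "w x y = complex_of_real (cmod (\<psi> x) * exp (- (b/2) * (norm x)\<^sup>2))
       * complex_of_real (M * sqrt pi ^ DIM('a) * exp (- (1/8) * (norm y)\<^sup>2))" for x y :: 'a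
  have wint: "integrable (lborel \<Otimes>\<^sub>M lborel) (\<lambda>s. w (fst s) (snd s))"
    unfolding w_def using L2 b
    by (intro integrable_lborel_pair_mult integrable_of_real integrable_L2_mult_gaussian
        integrable_mult_right integrable_gaussian) auto
  have step: "(LINT z|lborel. u z * (LINT x|lborel. \<psi> x * complex_of_real (gauss_hat ((d n)\<^sup>2) (x - z))))
      = (LINT s|(lborel \<Otimes>\<^sub>M lborel). \<psi> (fst s) * (u (fst s - d n *\<^sub>R snd s) * complex_of_real (g1 (snd s))))"
    and bound: "AE s in (lborel \<Otimes>\<^sub>M lborel). norm (\<psi> (fst s) * (u (fst s - d n *\<^sub>R snd s) * complex_of_real (g1 (snd s))))
       \<le> cmod (w (fst s) (snd s))" for n
  proof -
    have bd: "norm (\<psi> x * (u (x - d n *\<^sub>R y) * complex_of_real (g1 y))) \<le> cmod (w x y)" for x y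
    proof -
      have "(norm x)\<^sup>2 \<le> 2 * (norm (d n *\<^sub>R y))\<^sup>2 + 2 * (norm (x - d n *\<^sub>R y))\<^sup>2"
        using norm_sq_le_twice_diff[of x "d n *\<^sub>R y"] by simp
      also have "(norm (d n *\<^sub>R y))\<^sup>2 \<le> (norm y)\<^sup>2"
        using d[of n] by (auto intro!: power_mono mult_left_le_one_le simp: abs_mult)
      finally have "(b/2) * (norm x)\<^sup>2 \<le> (b/2) * (2 * (norm y)\<^sup>2 + 2 * (norm (x - d n *\<^sub>R y))\<^sup>2)"
        using b by (intro mult_left_mono) auto
      also have "\<dots> = b * (norm y)\<^sup>2 + b * (norm (x - d n *\<^sub>R y))\<^sup>2" by (simp add: algebra_simps)
      also have "b * (norm y)\<^sup>2 \<le> (1/8) * (norm y)\<^sup>2" using b by (intro mult_right_mono) auto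
      finally have *: "- b * (norm (x - d n *\<^sub>R y))\<^sup>2 + - (norm y)\<^sup>2 / 4 \<le> - (b/2) * (norm x)\<^sup>2 + - (1/8) * (norm y)\<^sup>2"
        by simp
      have "cmod (u (x - d n *\<^sub>R y)) * g1 y \<le> (M * exp (- b * (norm (x - d n *\<^sub>R y))\<^sup>2)) * g1 y"
        by (intro mult_right_mono u) (simp add: g1_def)
      also have "\<dots> = M * sqrt pi ^ DIM('a) * exp (- b * (norm (x - d n *\<^sub>R y))\<^sup>2 + - (norm y)\<^sup>2 / 4)"
        by (subst exp_add) (simp add: g1_def gauss_hat_def)
      also have "\<dots> \<le> M * sqrt pi ^ DIM('a) * exp (- (b/2) * (norm x)\<^sup>2 + - (1/8) * (norm y)\<^sup>2)"
        using * M by (intro mult_left_mono) auto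
      also have "\<dots> = exp (- (b/2) * (norm x)\<^sup>2) * (M * sqrt pi ^ DIM('a) * exp (- (1/8) * (norm y)\<^sup>2))"
        by (simp only: exp_add mult_ac)
      finally have "cmod (\<psi> x) * (cmod (u (x - d n *\<^sub>R y)) * g1 y)
         \<le> cmod (\<psi> x) * (exp (- (b/2) * (norm x)\<^sup>2) * (M * sqrt pi ^ DIM('a) * exp (- (1/8) * (norm y)\<^sup>2)))"
        by (rule mult_left_mono) simp
      then show ?thesis using M by (simp add: norm_mult norm_power w_def g1_def abs_mult mult.assoc)
    qed
    then show "AE s in (lborel \<Otimes>\<^sub>M lborel). norm (\<psi> (fst s) * (u (fst s - d n *\<^sub>R snd s) * complex_of_real (g1 (snd s))))
       \<le> cmod (w (fst s) (snd s))" by simp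
    have int1: "integrable (lborel \<Otimes>\<^sub>M lborel) (\<lambda>s. \<psi> (fst s) * (u (fst s - d n *\<^sub>R snd s) * complex_of_real (g1 (snd s))))"
      by (rule Bochner_Integration.integrable_bound[OF wint]) (use bd in auto)
    \<comment> \<open>A rate available both in \<open>u\<close> and in the kernel, so that their
      exponents can be compared with |z|^2 and |x - z|^2 at once. It may depend on \<open>n\<close>,
      since it serves only to justify Fubini for each fixed \<open>n\<close>.\<close>
    define c where "c = min b (1 / (4 * (d n)\<^sup>2))"
    have c: "c > 0" "c \<le> b" "c \<le> 1 / (4 * (d n)\<^sup>2)" using b d[of n] by (auto simp: c_def)
    have int2: "integrable (lborel \<Otimes>\<^sub>M lborel)
       (\<lambda>(x, z). \<psi> x * (u z * complex_of_real (gauss_hat ((d n)\<^sup>2) (x - z))))"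
    proof (rule Bochner_Integration.integrable_bound)
      show "integrable (lborel \<Otimes>\<^sub>M lborel) (\<lambda>s. complex_of_real (cmod (\<psi> (fst s)) * exp (- (c/4) * (norm (fst s))\<^sup>2))
       * complex_of_real (M * sqrt (pi / (d n)\<^sup>2) ^ DIM('a) * exp (- (c/2) * (norm (snd s))\<^sup>2)))"
        using L2 c
        by (intro integrable_lborel_pair_mult[where f="\<lambda>x. complex_of_real (cmod (\<psi> x) * exp (- (c/4) * (norm x)\<^sup>2))"
             and g="\<lambda>z. complex_of_real (M * sqrt (pi / (d n)\<^sup>2) ^ DIM('a) * exp (- (c/2) * (norm z)\<^sup>2))"]
           integrable_of_real integrable_L2_mult_gaussian integrable_mult_right integrable_gaussian) auto
      have "cmod (u z) * gauss_hat ((d n)\<^sup>2) (x - z)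
          \<le> exp (- (c/4) * (norm x)\<^sup>2) * (M * sqrt (pi / (d n)\<^sup>2) ^ DIM('a) * exp (- (c/2) * (norm z)\<^sup>2))" for x z
      proof -
        have "c * (norm (x - z))\<^sup>2 \<le> (norm (x - z))\<^sup>2 / (4 * (d n)\<^sup>2)"
          using mult_right_mono[OF c(3), of "(norm (x - z))\<^sup>2"] by simp
        moreover have "c * (norm z)\<^sup>2 \<le> b * (norm z)\<^sup>2" using c by (intro mult_right_mono) auto
        moreover have "(c/4) * (norm x)\<^sup>2 \<le> (c/4) * (2 * (norm (x - z))\<^sup>2 + 2 * (norm z)\<^sup>2)"
          using c norm_sq_le_twice_diff[of x z] by (intro mult_left_mono) auto
        moreover have "(c/4) * (2 * (norm (x - z))\<^sup>2 + 2 * (norm z)\<^sup>2) = c * (norm (x - z))\<^sup>2 / 2 + c * (norm z)\<^sup>2 / 2"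
          by (simp add: algebra_simps)
        moreover have "c * (norm (x - z))\<^sup>2 \<ge> 0" using c by simp
        ultimately have *: "- b * (norm z)\<^sup>2 + - (norm (x - z))\<^sup>2 / (4 * (d n)\<^sup>2) \<le> - (c/4) * (norm x)\<^sup>2 + - (c/2) * (norm z)\<^sup>2"
          by simp
        have "cmod (u z) * gauss_hat ((d n)\<^sup>2) (x - z) \<le> (M * exp (- b * (norm z)\<^sup>2)) * gauss_hat ((d n)\<^sup>2) (x - z)"
          using d[of n] by (intro mult_right_mono u) auto
        also have "\<dots> = M * sqrt (pi / (d n)\<^sup>2) ^ DIM('a) * exp (- b * (norm z)\<^sup>2 + - (norm (x - z))\<^sup>2 / (4 * (d n)\<^sup>2))"
          by (subst exp_add) (simp add: gauss_hat_def)
        also have "\<dots> \<le> M * sqrt (pi / (d n)\<^sup>2) ^ DIM('a) * exp (- (c/4) * (norm x)\<^sup>2 + - (c/2) * (norm z)\<^sup>2)"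
          using * M by (intro mult_left_mono) auto
        also have "\<dots> = exp (- (c/4) * (norm x)\<^sup>2) * (M * sqrt (pi / (d n)\<^sup>2) ^ DIM('a) * exp (- (c/2) * (norm z)\<^sup>2))"
          by (simp only: exp_add mult_ac)
        finally show ?thesis .
      qed
      from mult_left_mono[OF this, of "cmod (\<psi> x)" for x]
      show "AE s in (lborel \<Otimes>\<^sub>M lborel). norm (case s of (x, z) \<Rightarrow> \<psi> x * (u z * complex_of_real (gauss_hat ((d n)\<^sup>2) (x - z))))
        \<le> norm (complex_of_real (cmod (\<psi> (fst s)) * exp (- (c/4) * (norm (fst s))\<^sup>2))
       * complex_of_real (M * sqrt (pi / (d n)\<^sup>2) ^ DIM('a) * exp (- (c/2) * (norm (snd s))\<^sup>2)))"
        using M d[of n] by (auto simp: norm_mult norm_power abs_mult mult.assoc)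
    qed measurable
    have "(LINT z|lborel. u z * (LINT x|lborel. \<psi> x * complex_of_real (gauss_hat ((d n)\<^sup>2) (x - z))))
        = (LINT z|lborel. LINT x|lborel. \<psi> x * (u z * complex_of_real (gauss_hat ((d n)\<^sup>2) (x - z))))"
      by (simp add: mult.left_commute flip: integral_mult_right_zero)
    also have "\<dots> = (LINT x|lborel. LINT z|lborel. \<psi> x * (u z * complex_of_real (gauss_hat ((d n)\<^sup>2) (x - z))))"
      using lborel_pair.Fubini_integral[OF int2] by simp
    also have "\<dots> = (LINT x|lborel. LINT y|lborel. \<psi> x * (u (x - d n *\<^sub>R y) * complex_of_real (g1 y)))"
      using gauss_hat_shift_scale[OF d(1)[of n], of u] by (simp add: g1_def)
    also have "\<dots> = (LINT s|(lborel \<Otimes>\<^sub>M lborel). \<psi> (fst s) * (u (fst s - d n *\<^sub>R snd s) * complex_of_real (g1 (snd s))))"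
      using lborel_pair.integral_fst'[OF int1] by simp
    finally show "(LINT z|lborel. u z * (LINT x|lborel. \<psi> x * complex_of_real (gauss_hat ((d n)\<^sup>2) (x - z))))
      = (LINT s|(lborel \<Otimes>\<^sub>M lborel). \<psi> (fst s) * (u (fst s - d n *\<^sub>R snd s) * complex_of_real (g1 (snd s))))" .
  qed
  have d0: "d \<longlonglongrightarrow> 0" unfolding d_def by (rule LIMSEQ_Suc[OF lim_1_over_n])
  have "(\<lambda>n. LINT s|(lborel \<Otimes>\<^sub>M lborel). \<psi> (fst s) * (u (fst s - d n *\<^sub>R snd s) * complex_of_real (g1 (snd s))))
     \<longlonglongrightarrow> (LINT s|(lborel \<Otimes>\<^sub>M lborel). \<psi> (fst s) * (u (fst s) * complex_of_real (g1 (snd s))))"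
  proof (rule integral_dominated_convergence[where w="\<lambda>s. cmod (w (fst s) (snd s))"])
    show "integrable (lborel \<Otimes>\<^sub>M lborel) (\<lambda>s. cmod (w (fst s) (snd s)))"
      using wint by (rule integrable_norm)
    show "AE s in (lborel \<Otimes>\<^sub>M lborel). (\<lambda>n. \<psi> (fst s) * (u (fst s - d n *\<^sub>R snd s) * complex_of_real (g1 (snd s))))
        \<longlonglongrightarrow> \<psi> (fst s) * (u (fst s) * complex_of_real (g1 (snd s)))"
    proof (intro AE_I2 tendsto_mult tendsto_const)
      fix s :: "'a \<times> 'a"
      have "(\<lambda>n. fst s - d n *\<^sub>R snd s) \<longlonglongrightarrow> fst s"
        using tendsto_diff[OF tendsto_const tendsto_scaleR[OF d0 tendsto_const]] by fastforce
      moreover have "isCont u (fst s)" using cont by (simp add: continuous_on_eq_continuous_at)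
      ultimately show "(\<lambda>n. u (fst s - d n *\<^sub>R snd s)) \<longlonglongrightarrow> u (fst s)"
        using isCont_tendsto_compose by blast
    qed
  qed (use bound in auto)
  also have "(LINT s|(lborel \<Otimes>\<^sub>M lborel). \<psi> (fst s) * (u (fst s) * complex_of_real (g1 (snd s))))
      = complex_of_real ((2 * pi) ^ DIM('a)) * (LINT x|lborel. \<psi> x * u x)"
  proof -
    have i1: "integrable lborel (\<lambda>x. \<psi> x * u x)"
      using integrable_mult_right[OF integrable_L2_mult_gaussian[OF _ L2 b(1)], of M]
      by (rule Bochner_Integration.integrable_bound)
         (use M u mult_left_mono[OF u, of "cmod (\<psi> x)" for x] in \<open>auto simp: norm_mult abs_mult mult_ac\<close>)
    have i2: "integrable lborel (\<lambda>y. complex_of_real (g1 y))"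
      using integrable_gaussian[of "1/4", where 'a='a]
      by (auto simp: g1_def gauss_hat_def intro!: integrable_of_real integrable_mult_right)
    have "(LINT s|(lborel \<Otimes>\<^sub>M lborel). \<psi> (fst s) * (u (fst s) * complex_of_real (g1 (snd s))))
       = (LINT s|(lborel \<Otimes>\<^sub>M lborel). (\<psi> (fst s) * u (fst s)) * complex_of_real (g1 (snd s)))"
      by (simp add: mult.assoc)
    also have "\<dots> = (LINT x|lborel. LINT y|lborel. \<psi> x * u x * complex_of_real (g1 y))"
      using lborel_pair.integral_fst'[OF integrable_lborel_pair_mult[OF i1 i2]] by simp
    also have "\<dots> = complex_of_real (LINT y|lborel. g1 y) * (LINT x|lborel. \<psi> x * u x)"
      by (simp add: mult.commute)
    finally show ?thesis by (simp add: g1_def integral_gauss_hat_1)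
  qed
  finally show ?thesis unfolding step[symmetric] by (simp add: d_def)
qed

section \<open>Duality for Gaussian-weighted norms\<close>

text \<open>Measurability suffices: a function that is not integrable has Bochner integral 0 by
  default, and the bound is then trivial.\<close>

lemma norm_integral_le_nn_integral:
  fixes f :: "'a \<Rightarrow> 'b::{banach,second_countable_topology}"
  assumes "f \<in> borel_measurable M"
  shows "ennreal (norm (integral\<^sup>L M f)) \<le> (\<integral>\<^sup>+x. ennreal (norm (f x)) \<partial>M)"
  by (cases "integrable M f") (auto simp: not_integrable_integral_eq integral_norm_bound_ennreal)

lemma weighted_Cauchy_Schwarz:
  fixes g k :: "'a \<Rightarrow> complex" and V :: "'a \<Rightarrow> real"
  assumes [measurable]: "g \<in> borel_measurable M" "k \<in> borel_measurable M" "V \<in> borel_measurable M"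
    and V: "\<And>x. V x \<ge> 0"
  shows "ennreal ((cmod (LINT z|M. complex_of_real (V z) * g z * k z))\<^sup>2)
     \<le> (\<integral>\<^sup>+z. ennreal (V z * (cmod (g z))\<^sup>2) \<partial>M) * (\<integral>\<^sup>+z. ennreal (V z * (cmod (k z))\<^sup>2) \<partial>M)"
proof -
  have "ennreal (cmod (LINT z|M. complex_of_real (V z) * g z * k z))
      \<le> (\<integral>\<^sup>+z. ennreal (norm (complex_of_real (V z) * g z * k z)) \<partial>M)"
    by (rule norm_integral_le_nn_integral) measurable
  also have "\<dots> = (\<integral>\<^sup>+z. ennreal (sqrt (V z) * cmod (g z)) * ennreal (sqrt (V z) * cmod (k z)) \<partial>M)"
    using V by (intro nn_integral_cong) (simp add: norm_mult flip: ennreal_mult')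
  finally have "(ennreal (cmod (LINT z|M. complex_of_real (V z) * g z * k z)))\<^sup>2
      \<le> (\<integral>\<^sup>+z. ennreal (sqrt (V z) * cmod (g z)) * ennreal (sqrt (V z) * cmod (k z)) \<partial>M)\<^sup>2"
    by (rule power_mono) simp
  also have "\<dots> \<le> (\<integral>\<^sup>+z. (ennreal (sqrt (V z) * cmod (g z)))\<^sup>2 \<partial>M) * (\<integral>\<^sup>+z. (ennreal (sqrt (V z) * cmod (k z)))\<^sup>2 \<partial>M)"
    by (rule Cauchy_Schwarz_nn_integral) auto
  finally show ?thesis
    using V by (simp add: ennreal_power power_mult_distrib)
qed

text \<open>Bounded and continuous, and tends to the conjugate of \<open>w\<close> as \<open>N\<close> grows.\<close>

definition trunc_cnj :: "real \<Rightarrow> complex \<Rightarrow> complex" where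
  "trunc_cnj N w = cnj w / complex_of_real (1 + (cmod w)\<^sup>2 / N)"

lemma trunc_cnj_denominator: "N \<ge> 1 \<Longrightarrow> 1 + (cmod w)\<^sup>2 / N \<ge> 1"
  by simp

lemma norm_trunc_cnj:
  assumes "N \<ge> 1"
  shows "cmod (trunc_cnj N w) = cmod w / (1 + (cmod w)\<^sup>2 / N)"
  using trunc_cnj_denominator[OF assms, of w]
  by (simp only: trunc_cnj_def norm_divide complex_mod_cnj norm_of_real abs_of_nonneg)

lemma norm_trunc_cnj_le:
  assumes N: "N \<ge> 1"
  shows "cmod (trunc_cnj N w) \<le> N" and "cmod (trunc_cnj N w) \<le> cmod w"
proof -
  have "cmod w \<le> 1 + (cmod w)\<^sup>2"
    using sum_squares_bound[of "cmod w" 1] norm_ge_zero[of w]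
    unfolding one_power2 mult_1_right by linarith
  also have "\<dots> \<le> N * (1 + (cmod w)\<^sup>2 / N)"
    using N by (simp add: field_simps)
  finally show "cmod (trunc_cnj N w) \<le> N"
    using trunc_cnj_denominator[OF N, of w] by (subst norm_trunc_cnj[OF N], subst divide_le_eq) auto
  show "cmod (trunc_cnj N w) \<le> cmod w"
    using trunc_cnj_denominator[OF N, of w] mult_left_mono[OF trunc_cnj_denominator[OF N, of w], of "cmod w"]
    by (subst norm_trunc_cnj[OF N], subst divide_le_eq) auto
qed

lemma continuous_trunc_cnj:
  assumes N: "N \<ge> 1"
  shows "continuous_on UNIV (trunc_cnj N)"
proof -
  have "complex_of_real (1 + (cmod w)\<^sup>2 / N) \<noteq> 0" for w
    using trunc_cnj_denominator[OF N, of w] by (simp only: of_real_eq_0_iff)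
  then show ?thesis unfolding trunc_cnj_def by (intro continuous_intros ballI) (use N in auto)
qed

text \<open>The product is real, nonnegative and at least the squared modulus of
  \<open>trunc_cnj N w\<close>. Thus pairing \<open>\<psi>\<close> with its truncated conjugate
  yields an integral that also dominates the weighted norm of the test function.\<close>

lemma mult_trunc_cnj:
  "w * trunc_cnj N w = complex_of_real ((cmod w)\<^sup>2 / (1 + (cmod w)\<^sup>2 / N))"
  by (simp add: trunc_cnj_def complex_norm_square[symmetric] del: of_real_add)

text \<open>The mollified \<open>\<psi>\<close> converges only weakly here: pairing it with continuous bounded functions that
  tend almost everywhere to a bounded version of the conjugate of \<open>\<psi>\<close> recovers the norm of \<open>\<psi>\<close>.\<close>

lemma gaussian_weighted_norm_le_mollified:
  fixes \<psi> :: "'a::euclidean_space \<Rightarrow> complex"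
  assumes [measurable]: "\<psi> \<in> borel_measurable borel"
    and L2: "integrable lborel (\<lambda>x. (cmod (\<psi> x))\<^sup>2)" and a: "a > 0"
    and B: "\<And>\<epsilon>. \<epsilon> > 0 \<Longrightarrow> (\<integral>\<^sup>+z. ennreal (exp (- a * (norm z)\<^sup>2)
          * (cmod (LINT x|lborel. \<psi> x * complex_of_real (gauss_hat \<epsilon> (x - z))))\<^sup>2) \<partial>lborel) \<le> B"
  shows "ennreal ((2 * pi) ^ (2 * DIM('a))) * (\<integral>\<^sup>+x. ennreal (exp (- a * (norm x)\<^sup>2) * (cmod (\<psi> x))\<^sup>2) \<partial>lborel) \<le> B"
proof (cases B)
  case (real B')
  define C where "C = ((2 * pi) ^ DIM('a) :: real)"
  have C: "C > 0" by (simp add: C_def)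
  define V where "V x = exp (- a * (norm x)\<^sup>2)" for x :: 'a
  define k where "k \<epsilon> z = (LINT x|lborel. \<psi> x * complex_of_real (gauss_hat \<epsilon> (x - z)))" for \<epsilon> z
  have [measurable]: "V \<in> borel_measurable borel" "k \<epsilon> \<in> borel_measurable borel" for \<epsilon>
    unfolding V_def k_def by measurable
  have Vc: "continuous_on UNIV V" unfolding V_def by (intro continuous_intros)
  have V0: "V x \<ge> 0" "V x \<le> 1" for x using a by (auto simp: V_def)
  have Vint: "integrable lborel V" unfolding V_def by (rule integrable_gaussian[OF a])
  have kB: "(\<integral>\<^sup>+z. ennreal (V z * (cmod (k \<epsilon> z))\<^sup>2) \<partial>lborel) \<le> ennreal B'" if "\<epsilon> > 0" for \<epsilon>
    using B[OF that] real by (simp add: V_def k_def)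
  \<comment> \<open>Cauchy-Schwarz bounds the pairing of \<open>g\<close> with each mollified
    \<open>\<psi>\<close> by the uniform \<open>B'\<close>. In the limit the mollified function is
    replaced by \<open>C\<close> times \<open>\<psi>\<close>, whence the factor
    \<open>C\<^sup>2\<close>.\<close>
  have dual: "C\<^sup>2 * (cmod (LINT x|lborel. \<psi> x * (complex_of_real (V x) * g x)))\<^sup>2
       \<le> (LINT x|lborel. V x * (cmod (g x))\<^sup>2) * B'"
    if g: "continuous_on UNIV g" "\<And>x. cmod (g x) \<le> M" for g M
  proof -
    have [measurable]: "g \<in> borel_measurable borel" using g(1) by (rule borel_measurable_continuous_onI)
    have M: "M \<ge> 0" using order_trans[OF norm_ge_zero g(2)] by simp
    have gint: "integrable lborel (\<lambda>x. V x * (cmod (g x))\<^sup>2)"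
      by (rule Bochner_Integration.integrable_bound[OF integrable_mult_left[OF Vint, of "M\<^sup>2"]])
         (use V0 g M in \<open>auto simp: abs_mult intro!: mult_left_mono power_mono\<close>)
    \<comment> \<open>The weight decays at rate \<open>a\<close>, possibly above 1/8; only the
      slower rate is claimed, to meet the restriction in
      \<open>mollification_duality\<close>.\<close>
    define b where "b = min a (1/8)"
    have b: "0 < b" "b \<le> 1/8" "b \<le> a" using a by (auto simp: b_def)
    have u: "cmod (complex_of_real (V x) * g x) \<le> M * exp (- b * (norm x)\<^sup>2)" for x
    proof -
      have "V x * cmod (g x) \<le> exp (- b * (norm x)\<^sup>2) * M"
        using V0 g b by (intro mult_mono) (auto simp: V_def intro!: mult_right_mono)
      then show ?thesis using V0 by (simp add: norm_mult mult.commute)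
    qed
    have "(\<lambda>n. LINT z|lborel. complex_of_real (V z) * g z * k ((1 / real (Suc n))\<^sup>2) z)
           \<longlonglongrightarrow> complex_of_real C * (LINT x|lborel. \<psi> x * (complex_of_real (V x) * g x))"
      unfolding k_def C_def
      by (rule mollification_duality[OF _ L2 _ u b(1,2)])
         (auto intro!: continuous_intros g Vc)
    then have lim: "(\<lambda>n. (cmod (LINT z|lborel. complex_of_real (V z) * g z * k ((1 / real (Suc n))\<^sup>2) z))\<^sup>2)
           \<longlonglongrightarrow> (cmod (complex_of_real C * (LINT x|lborel. \<psi> x * (complex_of_real (V x) * g x))))\<^sup>2"
      by (intro tendsto_intros)
    have "(cmod (LINT z|lborel. complex_of_real (V z) * g z * k ((1 / real (Suc n))\<^sup>2) z))\<^sup>2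
        \<le> (LINT x|lborel. V x * (cmod (g x))\<^sup>2) * B'" for n
    proof -
      have "ennreal ((cmod (LINT z|lborel. complex_of_real (V z) * g z * k ((1 / real (Suc n))\<^sup>2) z))\<^sup>2)
         \<le> (\<integral>\<^sup>+z. ennreal (V z * (cmod (g z))\<^sup>2) \<partial>lborel)
            * (\<integral>\<^sup>+z. ennreal (V z * (cmod (k ((1 / real (Suc n))\<^sup>2) z))\<^sup>2) \<partial>lborel)"
        by (rule weighted_Cauchy_Schwarz) (auto simp: V0)
      also have "\<dots> \<le> (\<integral>\<^sup>+z. ennreal (V z * (cmod (g z))\<^sup>2) \<partial>lborel) * ennreal B'"
        by (intro mult_left_mono kB) auto
      also have "(\<integral>\<^sup>+z. ennreal (V z * (cmod (g z))\<^sup>2) \<partial>lborel) = ennreal (LINT x|lborel. V x * (cmod (g x))\<^sup>2)"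
        using gint V0 by (intro nn_integral_eq_integral) auto
      finally show ?thesis
        using V0 real by (simp add: ennreal_mult'[symmetric] ennreal_le_iff)
    qed
    then have "(cmod (complex_of_real C * (LINT x|lborel. \<psi> x * (complex_of_real (V x) * g x))))\<^sup>2
        \<le> (LINT x|lborel. V x * (cmod (g x))\<^sup>2) * B'"
      by (intro LIMSEQ_le_const2[OF lim]) auto
    then show ?thesis using C by (simp add: norm_mult power_mult_distrib)
  qed
  have \<psi>V: "integrable lborel (\<lambda>x. cmod (\<psi> x) * V x)"
    unfolding V_def using L2 a by (intro integrable_L2_mult_gaussian) auto
  have L2V: "integrable lborel (\<lambda>x. V x * (cmod (\<psi> x))\<^sup>2)"
    by (rule Bochner_Integration.integrable_bound[OF L2])
       (use V0 in \<open>auto simp: abs_mult intro!: mult_left_le_one_le\<close>)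
  \<comment> \<open>This notion of measurability provides continuous functions converging to
    \<open>\<psi>\<close> off a null set. Composed with \<open>trunc_cnj N\<close> they are bounded
    and continuous, hence admissible in \<open>dual\<close>.\<close>
  have "\<psi> measurable_on UNIV"
    by (simp add: measurable_on_iff_borel_measurable lebesgue_on_UNIV_eq measurable_completion)
  then obtain Z gs where Z: "negligible Z" and gs: "\<And>n. continuous_on UNIV (gs n)"
     and gslim: "\<And>x. x \<notin> Z \<Longrightarrow> (\<lambda>n. gs n x) \<longlonglongrightarrow> \<psi> x"
    unfolding measurable_on_def by auto
  have "AE x in lebesgue. x \<notin> Z"
    using Z by (auto simp: negligible_iff_null_sets intro: AE_not_in)
  then have AEZ: "AE x in lborel. x \<notin> Z" by (simp add: AE_completion_iff)
  have [measurable]: "gs n \<in> borel_measurable borel" for n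
    using gs by (rule borel_measurable_continuous_onI)
  have trunc: "C\<^sup>2 * (LINT x|lborel. V x * ((cmod (\<psi> x))\<^sup>2 / (1 + (cmod (\<psi> x))\<^sup>2 / N))) \<le> B'" if N: "N \<ge> 1" for N
  proof -
    note tc = continuous_trunc_cnj[OF N]
    have [measurable]: "trunc_cnj N \<in> borel_measurable borel"
      using tc by (rule borel_measurable_continuous_onI)
    let ?I = "LINT x|lborel. V x * ((cmod (\<psi> x))\<^sup>2 / (1 + (cmod (\<psi> x))\<^sup>2 / N))"
    have lim: "AE x in lborel. (\<lambda>n. trunc_cnj N (gs n x)) \<longlonglongrightarrow> trunc_cnj N (\<psi> x)"
      using AEZ
    proof eventually_elim
      case (elim x)
      have "isCont (trunc_cnj N) (\<psi> x)" using tc by (simp add: continuous_on_eq_continuous_at)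
      then show ?case using gslim[OF elim] by (rule isCont_tendsto_compose)
    qed
    have l1: "(\<lambda>n. LINT x|lborel. \<psi> x * (complex_of_real (V x) * trunc_cnj N (gs n x)))
        \<longlonglongrightarrow> (LINT x|lborel. \<psi> x * (complex_of_real (V x) * trunc_cnj N (\<psi> x)))"
    proof (rule integral_dominated_convergence[where w="\<lambda>x. cmod (\<psi> x) * V x * N"])
      show "integrable lborel (\<lambda>x. cmod (\<psi> x) * V x * N)" using \<psi>V by simp
      show "AE x in lborel. (\<lambda>n. \<psi> x * (complex_of_real (V x) * trunc_cnj N (gs n x)))
          \<longlonglongrightarrow> \<psi> x * (complex_of_real (V x) * trunc_cnj N (\<psi> x))"
        using lim by eventually_elim (intro tendsto_intros)
      show "AE x in lborel. norm (\<psi> x * (complex_of_real (V x) * trunc_cnj N (gs n x))) \<le> cmod (\<psi> x) * V x * N" for n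
        using V0 norm_trunc_cnj_le(1)[OF N] by (auto simp: norm_mult mult.assoc intro!: mult_left_mono)
    qed auto
    have l2: "(\<lambda>n. LINT x|lborel. V x * (cmod (trunc_cnj N (gs n x)))\<^sup>2)
        \<longlonglongrightarrow> (LINT x|lborel. V x * (cmod (trunc_cnj N (\<psi> x)))\<^sup>2)"
    proof (rule integral_dominated_convergence[where w="\<lambda>x. V x * N\<^sup>2"])
      show "integrable lborel (\<lambda>x. V x * N\<^sup>2)" using Vint by simp
      show "AE x in lborel. (\<lambda>n. V x * (cmod (trunc_cnj N (gs n x)))\<^sup>2)
          \<longlonglongrightarrow> V x * (cmod (trunc_cnj N (\<psi> x)))\<^sup>2"
        using lim by eventually_elim (intro tendsto_intros)
      show "AE x in lborel. norm (V x * (cmod (trunc_cnj N (gs n x)))\<^sup>2) \<le> V x * N\<^sup>2" for n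
        using V0 norm_trunc_cnj_le(1)[OF N] by (auto simp: abs_mult intro!: mult_left_mono power_mono)
    qed auto
    have "C\<^sup>2 * (cmod (LINT x|lborel. \<psi> x * (complex_of_real (V x) * trunc_cnj N (\<psi> x))))\<^sup>2
       \<le> (LINT x|lborel. V x * (cmod (trunc_cnj N (\<psi> x)))\<^sup>2) * B'"
    proof (rule LIMSEQ_le)
      show "(\<lambda>n. C\<^sup>2 * (cmod (LINT x|lborel. \<psi> x * (complex_of_real (V x) * trunc_cnj N (gs n x))))\<^sup>2)
         \<longlonglongrightarrow> C\<^sup>2 * (cmod (LINT x|lborel. \<psi> x * (complex_of_real (V x) * trunc_cnj N (\<psi> x))))\<^sup>2"
        by (intro tendsto_intros l1)
      show "(\<lambda>n. (LINT x|lborel. V x * (cmod (trunc_cnj N (gs n x)))\<^sup>2) * B')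
         \<longlonglongrightarrow> (LINT x|lborel. V x * (cmod (trunc_cnj N (\<psi> x)))\<^sup>2) * B'"
        by (intro tendsto_intros l2)
      have "continuous_on UNIV (\<lambda>x. trunc_cnj N (gs n x))" for n
        using continuous_on_compose2[OF tc gs] by simp
      then show "\<exists>n0. \<forall>n\<ge>n0. C\<^sup>2 * (cmod (LINT x|lborel. \<psi> x * (complex_of_real (V x) * trunc_cnj N (gs n x))))\<^sup>2
          \<le> (LINT x|lborel. V x * (cmod (trunc_cnj N (gs n x)))\<^sup>2) * B'"
        using dual norm_trunc_cnj_le(1)[OF N] by blast
    qed
    also have "(LINT x|lborel. \<psi> x * (complex_of_real (V x) * trunc_cnj N (\<psi> x))) = complex_of_real ?I"
    proof -
      have "\<psi> x * (complex_of_real (V x) * trunc_cnj N (\<psi> x))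
          = complex_of_real (V x * ((cmod (\<psi> x))\<^sup>2 / (1 + (cmod (\<psi> x))\<^sup>2 / N)))" for x
        using mult_trunc_cnj[of "\<psi> x" N] by (simp only: mult.left_commute[of "\<psi> x"] of_real_mult)
      then show ?thesis by (simp only: integral_complex_of_real)
    qed
    also have "(LINT x|lborel. V x * (cmod (trunc_cnj N (\<psi> x)))\<^sup>2) * B' \<le> ?I * B'"
    proof (intro mult_right_mono integral_mono_AE)
      have tn: "(cmod (trunc_cnj N (\<psi> x)))\<^sup>2 \<le> (cmod (\<psi> x))\<^sup>2" for x
        using norm_trunc_cnj_le(2)[OF N] by (intro power_mono) auto
      show "integrable lborel (\<lambda>x. V x * (cmod (trunc_cnj N (\<psi> x)))\<^sup>2)"
        by (rule Bochner_Integration.integrable_bound[OF L2V])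
           (use V0 tn in \<open>auto simp: abs_mult intro!: mult_left_mono\<close>)
      have q: "(cmod (\<psi> x))\<^sup>2 / (1 + (cmod (\<psi> x))\<^sup>2 / N) \<le> (cmod (\<psi> x))\<^sup>2" for x
        using trunc_cnj_denominator[OF N, of "\<psi> x"] mult_left_mono[OF trunc_cnj_denominator[OF N, of "\<psi> x"], of "(cmod (\<psi> x))\<^sup>2"]
        by (subst divide_le_eq) auto
      have q0: "0 \<le> (cmod (\<psi> x))\<^sup>2 / (1 + (cmod (\<psi> x))\<^sup>2 / N)" for x
        using N by simp
      have "\<bar>V x * ((cmod (\<psi> x))\<^sup>2 / (1 + (cmod (\<psi> x))\<^sup>2 / N))\<bar> \<le> \<bar>V x * (cmod (\<psi> x))\<^sup>2\<bar>" for x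
        unfolding abs_mult abs_of_nonneg[OF V0(1)] abs_of_nonneg[OF q0] abs_of_nonneg[OF zero_le_power2]
        by (intro mult_left_mono q V0)
      then show "integrable lborel (\<lambda>x. V x * ((cmod (\<psi> x))\<^sup>2 / (1 + (cmod (\<psi> x))\<^sup>2 / N)))"
        by (intro Bochner_Integration.integrable_bound[OF L2V] AE_I2) (auto simp only: real_norm_def, measurable)
      have "(cmod (trunc_cnj N w))\<^sup>2 \<le> (cmod w)\<^sup>2 / (1 + (cmod w)\<^sup>2 / N)" for w
      proof -
        have "(cmod (trunc_cnj N w))\<^sup>2 \<le> cmod w * cmod (trunc_cnj N w)"
          using norm_trunc_cnj_le(2)[OF N, of w] by (simp add: power2_eq_square mult_right_mono)
        also have "\<dots> = (cmod w)\<^sup>2 / (1 + (cmod w)\<^sup>2 / N)"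
          by (simp only: norm_trunc_cnj[OF N] power2_eq_square times_divide_eq_right)
        finally show ?thesis .
      qed
      then show "AE x in lborel. V x * (cmod (trunc_cnj N (\<psi> x)))\<^sup>2
          \<le> V x * ((cmod (\<psi> x))\<^sup>2 / (1 + (cmod (\<psi> x))\<^sup>2 / N))"
        using V0(1) by (blast intro: AE_I2 mult_left_mono)
    qed (use real in auto)
    \<comment> \<open>Quadratic in \<open>?I\<close> on the left and linear on the right: cancelling
      one factor leaves a bound that does not depend on \<open>N\<close>. The case
      \<open>?I = 0\<close> is treated apart.\<close>
    finally have *: "C\<^sup>2 * ?I\<^sup>2 \<le> ?I * B'" by simp
    have I0: "?I \<ge> 0" using V0 N by (intro integral_nonneg_AE) auto
    show ?thesis
    proof (cases "?I = 0")
      case False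
      then have "?I > 0" using I0 by simp
      moreover have "?I * (C\<^sup>2 * ?I) \<le> ?I * B'" using * by (simp add: power2_eq_square mult_ac)
      ultimately show ?thesis by (simp only: mult_le_cancel_left_pos)
    qed (use real in simp)
  qed
  have "(\<lambda>n. LINT x|lborel. V x * ((cmod (\<psi> x))\<^sup>2 / (1 + (cmod (\<psi> x))\<^sup>2 / real (Suc n))))
      \<longlonglongrightarrow> (LINT x|lborel. V x * (cmod (\<psi> x))\<^sup>2)"
  proof (rule integral_dominated_convergence[where w="\<lambda>x. V x * (cmod (\<psi> x))\<^sup>2"])
    have "(\<lambda>n. t / real (Suc n)) \<longlonglongrightarrow> 0" for t :: real
      by (rule LIMSEQ_Suc[OF lim_const_over_n])
    from tendsto_divide[OF tendsto_const tendsto_add[OF tendsto_const this], of 1]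
    have "(\<lambda>n. t / (1 + t / real (Suc n))) \<longlonglongrightarrow> t" for t :: real
      by simp
    then show "AE x in lborel. (\<lambda>n. V x * ((cmod (\<psi> x))\<^sup>2 / (1 + (cmod (\<psi> x))\<^sup>2 / real (Suc n))))
      \<longlonglongrightarrow> V x * (cmod (\<psi> x))\<^sup>2" by (intro AE_I2 tendsto_mult tendsto_const)
    have "t / (1 + t / real (Suc n)) \<le> t" if "t \<ge> 0" for t n
    proof -
      have ge: "1 \<le> 1 + t / real (Suc n)" using that by simp
      then have pos: "0 < 1 + t / real (Suc n)" by linarith
      show ?thesis
        using mult_left_mono[OF ge that] by (simp only: pos_divide_le_eq[OF pos] mult_1_right)
    qed
    from this[OF zero_le_power2]
    have "V x * ((cmod (\<psi> x))\<^sup>2 / (1 + (cmod (\<psi> x))\<^sup>2 / real (Suc n))) \<le> V x * (cmod (\<psi> x))\<^sup>2" for x n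
      by (intro mult_left_mono V0)
    then show "AE x in lborel. norm (V x * ((cmod (\<psi> x))\<^sup>2 / (1 + (cmod (\<psi> x))\<^sup>2 / real (Suc n)))) \<le> V x * (cmod (\<psi> x))\<^sup>2" for n
      unfolding real_norm_def
      by (intro AE_I2, subst abs_of_nonneg) (auto intro!: V0 mult_nonneg_nonneg divide_nonneg_nonneg add_nonneg_nonneg)
  qed (use L2V in auto)
  then have "(\<lambda>n. C\<^sup>2 * (LINT x|lborel. V x * ((cmod (\<psi> x))\<^sup>2 / (1 + (cmod (\<psi> x))\<^sup>2 / real (Suc n)))))
      \<longlonglongrightarrow> C\<^sup>2 * (LINT x|lborel. V x * (cmod (\<psi> x))\<^sup>2)" by (intro tendsto_intros)
  then have "C\<^sup>2 * (LINT x|lborel. V x * (cmod (\<psi> x))\<^sup>2) \<le> B'"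
    by (rule LIMSEQ_le_const2) (intro exI[of _ 0] allI impI trunc, simp)
  then have "ennreal (C\<^sup>2 * (LINT x|lborel. V x * (cmod (\<psi> x))\<^sup>2)) \<le> B" using real by (simp add: ennreal_leI)
  moreover have "(\<integral>\<^sup>+x. ennreal (V x * (cmod (\<psi> x))\<^sup>2) \<partial>lborel) = ennreal (LINT x|lborel. V x * (cmod (\<psi> x))\<^sup>2)"
    using L2V V0 by (intro nn_integral_eq_integral) auto
  ultimately show ?thesis
    using C by (simp add: V_def C_def ennreal_mult' power_even_eq)
qed simp

section \<open>The Schur test\<close>

lemma nn_integral_lborel_reflect:
  fixes F :: "'a::euclidean_space \<Rightarrow> ennreal"
  assumes [measurable]: "F \<in> borel_measurable borel"
  shows "(\<integral>\<^sup>+q. F (p - q) \<partial>lborel) = (\<integral>\<^sup>+q. F q \<partial>lborel)"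
proof -
  have "lborel = density (distr lborel borel (\<lambda>q. p - q)) (\<lambda>_. 1)"
    using lborel_affine[of "- 1" p] by simp
  then have "(\<integral>\<^sup>+q. F q \<partial>lborel) = (\<integral>\<^sup>+q. F q \<partial>density (distr lborel borel (\<lambda>q. p - q)) (\<lambda>_. 1))"
    by (rule arg_cong)
  also have "\<dots> = (\<integral>\<^sup>+q. F (p - q) \<partial>lborel)"
    by (subst nn_integral_density) (auto simp: nn_integral_distr)
  finally show ?thesis by simp
qed

text \<open>The density is minus the derivative of 1/(s (s^2 + beta^2)), which vanishes at infinity.
  A radial function thereby becomes a superposition of indicators of discs, and integrating it over
  the plane only takes the areas of discs.\<close>

lemma inverse_radial_layer_cake:
  fixes \<beta> r :: real
  assumes \<beta>: "\<beta> > 0" and r: "r > 0"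
  shows "(\<integral>\<^sup>+s. ennreal ((3 * s\<^sup>2 + \<beta>\<^sup>2) / (s\<^sup>2 * (s\<^sup>2 + \<beta>\<^sup>2)\<^sup>2)) * indicator {r..} s \<partial>lborel)
       = ennreal (1 / (r * (r\<^sup>2 + \<beta>\<^sup>2)))"
proof -
  have "(\<integral>\<^sup>+s. ennreal ((3 * s\<^sup>2 + \<beta>\<^sup>2) / (s\<^sup>2 * (s\<^sup>2 + \<beta>\<^sup>2)\<^sup>2)) * indicator {r..} s \<partial>lborel)
      = ennreal (0 - (- 1 / (r * (r\<^sup>2 + \<beta>\<^sup>2))))"
  proof (rule nn_integral_FTC_atLeast)
    fix s :: real assume "r \<le> s"
    then have s: "s > 0" using r by simp
    have nz: "s * (s\<^sup>2 + \<beta>\<^sup>2) \<noteq> 0" using s \<beta> by (simp add: add_pos_pos pos_add_strict less_imp_neq[symmetric])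
    have "((\<lambda>s. - 1 / (s * (s\<^sup>2 + \<beta>\<^sup>2))) has_real_derivative
        (1 * (s\<^sup>2 + \<beta>\<^sup>2) + s * (2 * s)) / (s * (s\<^sup>2 + \<beta>\<^sup>2))\<^sup>2) (at s)"
      using nz by (auto intro!: derivative_eq_intros simp: power2_eq_square) (auto simp: divide_simps)
    also have "(1 * (s\<^sup>2 + \<beta>\<^sup>2) + s * (2 * s)) / (s * (s\<^sup>2 + \<beta>\<^sup>2))\<^sup>2
        = (3 * s\<^sup>2 + \<beta>\<^sup>2) / (s\<^sup>2 * (s\<^sup>2 + \<beta>\<^sup>2)\<^sup>2)"
      by (simp add: power_mult_distrib power2_eq_square algebra_simps)
    finally show "((\<lambda>s. - 1 / (s * (s\<^sup>2 + \<beta>\<^sup>2))) has_real_derivative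
        (3 * s\<^sup>2 + \<beta>\<^sup>2) / (s\<^sup>2 * (s\<^sup>2 + \<beta>\<^sup>2)\<^sup>2)) (at s)" .
  next
    show "((\<lambda>s. - 1 / (s * (s\<^sup>2 + \<beta>\<^sup>2))) \<longlongrightarrow> 0) at_top" by real_asymp
  qed auto
  then show ?thesis by simp
qed

text \<open>In polar coordinates this is the integral of 2 pi / (r^2 + beta^2) over the half-line.
  Here the layer cake followed by Tonelli produces the areas pi s^2 and leaves a one-dimensional
  integral with an explicit antiderivative.\<close>

lemma nn_integral_inverse_radial:
  fixes \<beta> :: real
  assumes \<beta>: "\<beta> > 0"
  shows "(\<integral>\<^sup>+q. ennreal (1 / (norm q * ((norm (q::real^2))\<^sup>2 + \<beta>\<^sup>2))) \<partial>lborel) \<le> ennreal (pi\<^sup>2 / \<beta>)"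
proof -
  define h where "h s = (3 * s\<^sup>2 + \<beta>\<^sup>2) / (s\<^sup>2 * (s\<^sup>2 + \<beta>\<^sup>2)\<^sup>2)" for s :: real
  have [measurable]: "h \<in> borel_measurable borel" unfolding h_def by measurable
  have "(\<integral>\<^sup>+q. ennreal (1 / (norm q * ((norm (q::real^2))\<^sup>2 + \<beta>\<^sup>2))) \<partial>lborel)
      \<le> (\<integral>\<^sup>+q. \<integral>\<^sup>+s. ennreal (h s) * indicator {norm (q::real^2)..} s \<partial>lborel \<partial>lborel)"
  proof (rule nn_integral_mono)
    fix q :: "real^2"
    \<comment> \<open>At \<open>q = 0\<close> the left side is 0, because division by zero gives 0;
      this is why an inequality is stated.\<close>
    show "ennreal (1 / (norm q * ((norm q)\<^sup>2 + \<beta>\<^sup>2))) \<le> (\<integral>\<^sup>+s. ennreal (h s) * indicator {norm q..} s \<partial>lborel)"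
      by (cases "q = 0") (use inverse_radial_layer_cake[OF \<beta>, of "norm q"] in \<open>auto simp: h_def\<close>)
  qed
  also have "\<dots> = (\<integral>\<^sup>+q. \<integral>\<^sup>+s. ennreal (h s) * indicator {(q::real^2, s). norm q \<le> s} (q, s) \<partial>lborel \<partial>lborel)"
    by (intro nn_integral_cong) (auto split: split_indicator)
  also have "\<dots> = (\<integral>\<^sup>+s. \<integral>\<^sup>+q. ennreal (h s) * indicator {(q::real^2, s). norm q \<le> s} (q, s) \<partial>lborel \<partial>lborel)"
    by (rule lborel_pair.Fubini'[symmetric]) measurable
  also have "\<dots> = (\<integral>\<^sup>+s. ennreal (h s) * emeasure lborel (cball (0::real^2) s) \<partial>lborel)"
  proof (intro nn_integral_cong)
    fix s :: real
    have "(\<integral>\<^sup>+q. ennreal (h s) * indicator {(q::real^2, s). norm q \<le> s} (q, s) \<partial>lborel)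
        = (\<integral>\<^sup>+q. ennreal (h s) * indicator (cball (0::real^2) s) q \<partial>lborel)"
      by (intro nn_integral_cong) (auto split: split_indicator)
    then show "(\<integral>\<^sup>+q. ennreal (h s) * indicator {(q::real^2, s). norm q \<le> s} (q, s) \<partial>lborel)
        = ennreal (h s) * emeasure lborel (cball (0::real^2) s)"
      by (simp add: nn_integral_cmult_indicator)
  qed
  also have "\<dots> \<le> (\<integral>\<^sup>+s. ennreal (pi * (3 * s\<^sup>2 + \<beta>\<^sup>2) / (s\<^sup>2 + \<beta>\<^sup>2)\<^sup>2) * indicator {0..} s \<partial>lborel)"
  proof (rule nn_integral_mono)
    fix s :: real
    show "ennreal (h s) * emeasure lborel (cball (0::real^2) s)
       \<le> ennreal (pi * (3 * s\<^sup>2 + \<beta>\<^sup>2) / (s\<^sup>2 + \<beta>\<^sup>2)\<^sup>2) * indicator {0..} s"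
    proof (cases "s > 0")
      case True
      have "ennreal (h s) * emeasure lborel (cball (0::real^2) s) = ennreal (h s * (pi * s\<^sup>2))"
        using True by (simp add: emeasure_cball unit_ball_vol_2 ennreal_mult'')
      also have "h s * (pi * s\<^sup>2) = pi * (3 * s\<^sup>2 + \<beta>\<^sup>2) / (s\<^sup>2 + \<beta>\<^sup>2)\<^sup>2"
        using True by (simp add: h_def)
      finally show ?thesis using True by simp
    next
      case False
      \<comment> \<open>For negative \<open>s\<close> the ball is empty, and \<open>h 0\<close> is 0
        as a quotient by zero.\<close>
      then show ?thesis by (cases "s = 0") (auto simp: h_def)
    qed
  qed
  also have "\<dots> = ennreal (pi\<^sup>2 / \<beta> - pi * (2 / \<beta> * arctan (0 / \<beta>) - 0 / (0\<^sup>2 + \<beta>\<^sup>2)))"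
  proof (rule nn_integral_FTC_atLeast)
    fix s :: real
    have pos: "s\<^sup>2 + \<beta>\<^sup>2 > 0" using \<beta> by (simp add: add_nonneg_pos)
    have pos2: "1 + (s / \<beta>)\<^sup>2 > 0" by (simp add: add_pos_nonneg)
    \<comment> \<open>The antiderivative comes from writing 3 s^2 + beta^2 as 2 (s^2 + beta^2) -
      (beta^2 - s^2): the first part integrates to an arctangent, the second to s / (s^2 +
      beta^2).\<close>
    have "((\<lambda>s. pi * (2 / \<beta> * arctan (s / \<beta>) - s / (s\<^sup>2 + \<beta>\<^sup>2))) has_real_derivative
       pi * (2 / \<beta> * (1 / \<beta> * inverse (1 + (s / \<beta>)\<^sup>2)) - (1 * (s\<^sup>2 + \<beta>\<^sup>2) - s * (2 * s)) / (s\<^sup>2 + \<beta>\<^sup>2)\<^sup>2)) (at s)"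
      using pos \<beta> by (auto intro!: derivative_eq_intros simp: power2_eq_square)
    also have "2 / \<beta> * (1 / \<beta> * inverse (1 + (s / \<beta>)\<^sup>2)) = 2 / (s\<^sup>2 + \<beta>\<^sup>2)"
      using pos pos2 \<beta> by (simp add: field_simps power2_eq_square)
    also have "2 / (s\<^sup>2 + \<beta>\<^sup>2) - (1 * (s\<^sup>2 + \<beta>\<^sup>2) - s * (2 * s)) / (s\<^sup>2 + \<beta>\<^sup>2)\<^sup>2 = (3 * s\<^sup>2 + \<beta>\<^sup>2) / (s\<^sup>2 + \<beta>\<^sup>2)\<^sup>2"
      using pos by (simp add: divide_simps power2_eq_square)
    finally show "((\<lambda>s. pi * (2 / \<beta> * arctan (s / \<beta>) - s / (s\<^sup>2 + \<beta>\<^sup>2))) has_real_derivative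
       pi * (3 * s\<^sup>2 + \<beta>\<^sup>2) / (s\<^sup>2 + \<beta>\<^sup>2)\<^sup>2) (at s)" by simp
  next
    have "((\<lambda>s. pi * (2 / \<beta> * arctan (s / \<beta>) - s / (s\<^sup>2 + \<beta>\<^sup>2))) \<longlongrightarrow> pi * (2 / \<beta> * (pi / 2) - 0)) at_top"
    proof (intro tendsto_intros)
      have "filterlim (\<lambda>s. s / \<beta>) at_top at_top" using \<beta> by real_asymp
      then show "((\<lambda>s. arctan (s / \<beta>)) \<longlongrightarrow> pi / 2) at_top"
        by (rule filterlim_compose[OF tendsto_arctan_at_top])
      show "((\<lambda>s. s / (s\<^sup>2 + \<beta>\<^sup>2)) \<longlongrightarrow> 0) at_top" by real_asymp
    qed
    then show "((\<lambda>s. pi * (2 / \<beta> * arctan (s / \<beta>) - s / (s\<^sup>2 + \<beta>\<^sup>2))) \<longlongrightarrow> pi\<^sup>2 / \<beta>) at_top"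
      by (simp add: power2_eq_square)
  qed auto
  finally show ?thesis by simp
qed

text \<open>Both factors decrease in the norm, so exchanging their arguments
  can only increase the sum of the products (rearrangement inequality).\<close>

lemma nn_integral_shifted_inverse_radial:
  fixes \<beta> :: real and p :: "real^2"
  assumes \<beta>: "\<beta> > 0"
  shows "(\<integral>\<^sup>+q. ennreal (1 / norm q * (1 / ((norm (p - q))\<^sup>2 + \<beta>\<^sup>2))) \<partial>lborel) \<le> ennreal (pi\<^sup>2 / \<beta>)"
proof -
  define f where "f t = 1 / t" for t :: real
  define g where "g t = 1 / (t\<^sup>2 + \<beta>\<^sup>2)" for t :: real
  have [measurable]: "f \<in> borel_measurable borel" "g \<in> borel_measurable borel"
    unfolding f_def g_def by measurable
  have f0: "f t \<ge> 0" if "t \<ge> 0" for t using that by (simp add: f_def)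
  have g0: "g t \<ge> 0" for t by (simp add: g_def)
  define I where "I = (\<integral>\<^sup>+q. ennreal (f (norm q) * g (norm (p - q))) \<partial>lborel)"
  define J where "J = (\<integral>\<^sup>+q. ennreal (f (norm q) * g (norm (q::real^2))) \<partial>lborel)"
  \<comment> \<open>The reflection that sends q to p - q gives each of \<open>I\<close> and
    \<open>J\<close> a second form. Adding both forms puts the four products of the rearrangement
    inequality under two integrals.\<close>
  have I': "I = (\<integral>\<^sup>+q. ennreal (f (norm (p - q)) * g (norm q)) \<partial>lborel)"
    unfolding I_def
    by (subst nn_integral_lborel_reflect[symmetric, where p=p]) auto
  have J': "J = (\<integral>\<^sup>+q. ennreal (f (norm (p - q)) * g (norm (p - q))) \<partial>lborel)"
    unfolding J_def
    by (subst nn_integral_lborel_reflect[symmetric, where p=p]) auto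
  \<comment> \<open>At 0 the function \<open>f\<close> takes the default value 0 and is no longer
    decreasing, so the two points where a norm vanishes are left out.\<close>
  have "AE q in lborel. q \<noteq> 0" "AE q in lborel. q \<noteq> p" by (rule AE_lborel_singleton)+
  then have "AE q in lborel. ennreal (f (norm q) * g (norm (p - q))) + ennreal (f (norm (p - q)) * g (norm q))
       \<le> ennreal (f (norm q) * g (norm q)) + ennreal (f (norm (p - q)) * g (norm (p - q)))"
  proof eventually_elim
    case (elim q)
    have anti: "(f a - f b) * (g a - g b) \<ge> 0" if "a > 0" "b > 0" "a \<le> b" for a b
    proof -
      have "f b \<le> f a" unfolding f_def using that by (intro divide_left_mono) auto
      moreover have "g b \<le> g a" unfolding g_def using that \<beta>
        by (intro divide_left_mono add_right_mono power_mono mult_pos_pos add_nonneg_pos) auto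
      ultimately show ?thesis by simp
    qed
    have "(f (norm q) - f (norm (p - q))) * (g (norm q) - g (norm (p - q))) \<ge> 0"
      using anti[of "norm q" "norm (p - q)"] anti[of "norm (p - q)" "norm q"] elim
      by (cases "norm q \<le> norm (p - q)") (auto simp: algebra_simps)
    then show ?case
      using f0 g0 by (simp add: algebra_simps flip: ennreal_plus)
  qed
  then have "(\<integral>\<^sup>+q. ennreal (f (norm q) * g (norm (p - q))) + ennreal (f (norm (p - q)) * g (norm q)) \<partial>lborel)
      \<le> (\<integral>\<^sup>+q. ennreal (f (norm q) * g (norm q)) + ennreal (f (norm (p - q)) * g (norm (p - q))) \<partial>lborel)"
    by (rule nn_integral_mono_AE)
  then have "I + I \<le> J + J"
    by (simp add: nn_integral_add I_def[symmetric] I'[symmetric] J_def[symmetric] J'[symmetric])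
  then have "2 * I \<le> 2 * J" by (simp add: mult_2)
  then have "I \<le> J" by (simp add: ennreal_mult_le_mult_iff)
  also have "J \<le> ennreal (pi\<^sup>2 / \<beta>)"
    using nn_integral_inverse_radial[OF \<beta>] by (simp add: J_def f_def g_def)
  finally show ?thesis by (simp add: I_def f_def g_def)
qed

text \<open>The weight is chosen so that the surviving factor is \<open>norm p\<close>. Since the
  kernel is symmetric, the two halves of the arithmetic-geometric mean have the same double integral
  \<open>S\<close>, and in \<open>S\<close> the inner integral over \<open>q\<close> is bounded
  uniformly in \<open>p\<close>.\<close>

lemma Schur_test_inverse_norm:
  fixes \<phi> :: "real^2 \<Rightarrow> complex" and \<beta> :: real
  assumes [measurable]: "\<phi> \<in> borel_measurable borel" and \<beta>: "\<beta> > 0"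
  shows "(\<integral>\<^sup>+p. \<integral>\<^sup>+q. ennreal (cmod (\<phi> p) * cmod (\<phi> q) * (1 / ((norm (p - q))\<^sup>2 + \<beta>\<^sup>2))) \<partial>lborel \<partial>lborel)
    \<le> ennreal (pi\<^sup>2 / \<beta>) * (\<integral>\<^sup>+p. ennreal (norm p * (cmod (\<phi> p))\<^sup>2) \<partial>lborel)"
proof -
  define k where "k w = 1 / ((norm w)\<^sup>2 + \<beta>\<^sup>2)" for w :: "real^2"
  have [measurable]: "k \<in> borel_measurable borel" unfolding k_def by measurable
  have k0: "k w \<ge> 0" for w by (simp add: k_def)
  have ksym: "k (p - q) = k (q - p)" for p q by (simp add: k_def norm_minus_commute)
  define A where "A p q = ennreal (norm p * (cmod (\<phi> p))\<^sup>2) * ennreal (1 / norm q * k (p - q))" for p q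
  have [measurable]: "case_prod A \<in> borel_measurable (borel \<Otimes>\<^sub>M borel)" unfolding A_def by measurable
  define S where "S = (\<integral>\<^sup>+p. \<integral>\<^sup>+q. A p q \<partial>lborel \<partial>lborel)"
  have S': "S = (\<integral>\<^sup>+p. \<integral>\<^sup>+q. A q p \<partial>lborel \<partial>lborel)"
    unfolding S_def by (rule lborel_pair.Fubini'[symmetric]) simp
  have "2 * (\<integral>\<^sup>+p. \<integral>\<^sup>+q. ennreal (cmod (\<phi> p) * cmod (\<phi> q) * k (p - q)) \<partial>lborel \<partial>lborel)
     = (\<integral>\<^sup>+p. \<integral>\<^sup>+q. 2 * ennreal (cmod (\<phi> p) * cmod (\<phi> q) * k (p - q)) \<partial>lborel \<partial>lborel)"
    by (simp add: nn_integral_cmult)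
  also have "\<dots> \<le> (\<integral>\<^sup>+p. \<integral>\<^sup>+q. A p q + A q p \<partial>lborel \<partial>lborel)"
  proof (rule nn_integral_mono_AE)
    \<comment> \<open>Both \<open>p\<close> and \<open>q\<close> have to be nonzero for the
      quotients of their norms to cancel in \<open>x * y\<close>.\<close>
    have "AE p in lborel. p \<noteq> (0::real^2)" by (rule AE_lborel_singleton)
    then show "AE p in lborel. (\<integral>\<^sup>+q. 2 * ennreal (cmod (\<phi> p) * cmod (\<phi> q) * k (p - q)) \<partial>lborel)
        \<le> (\<integral>\<^sup>+q. A p q + A q p \<partial>lborel)"
    proof eventually_elim
      case (elim p)
      show ?case
      proof (rule nn_integral_mono_AE)
        have "AE q in lborel. q \<noteq> (0::real^2)" by (rule AE_lborel_singleton)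
        then show "AE q in lborel. 2 * ennreal (cmod (\<phi> p) * cmod (\<phi> q) * k (p - q)) \<le> A p q + A q p"
        proof eventually_elim
          case (elim q)
          \<comment> \<open>arithmetic-geometric mean with the weight \<open>1 / norm\<close>\<close>
          define x where "x = cmod (\<phi> p) * sqrt (norm p / norm q)"
          define y where "y = cmod (\<phi> q) * sqrt (norm q / norm p)"
          have "x * y = cmod (\<phi> p) * cmod (\<phi> q)"
            using elim \<open>p \<noteq> 0\<close> by (simp add: x_def y_def real_sqrt_divide)
          moreover have "x\<^sup>2 = norm p * (cmod (\<phi> p))\<^sup>2 * (1 / norm q)" "y\<^sup>2 = norm q * (cmod (\<phi> q))\<^sup>2 * (1 / norm p)"
            by (simp_all add: x_def y_def power_mult_distrib)
          ultimately have "2 * (cmod (\<phi> p) * cmod (\<phi> q)) \<le> norm p * (cmod (\<phi> p))\<^sup>2 * (1 / norm q) + norm q * (cmod (\<phi> q))\<^sup>2 * (1 / norm p)"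
            using sum_squares_bound[of x y] by (simp add: mult.assoc)
          from mult_right_mono[OF this k0[of "p - q"]]
          have "2 * (cmod (\<phi> p) * cmod (\<phi> q) * k (p - q))
             \<le> norm p * (cmod (\<phi> p))\<^sup>2 * (1 / norm q * k (p - q)) + norm q * (cmod (\<phi> q))\<^sup>2 * (1 / norm p * k (q - p))"
            by (simp add: algebra_simps ksym[of q p])
          then have "ennreal (2 * (cmod (\<phi> p) * cmod (\<phi> q) * k (p - q)))
             \<le> ennreal (norm p * (cmod (\<phi> p))\<^sup>2 * (1 / norm q * k (p - q)) + norm q * (cmod (\<phi> q))\<^sup>2 * (1 / norm p * k (q - p)))"
            by (rule ennreal_leI)
          also have "\<dots> = A p q + A q p"
            using k0 by (simp add: A_def ennreal_mult'' del: times_divide_eq_left)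
          finally show ?case using k0 by (simp add: ennreal_mult')
        qed
      qed
    qed
  qed
  also have "\<dots> = S + S"
    by (simp add: nn_integral_add) (simp add: S_def[symmetric] S'[symmetric])
  finally have "2 * (\<integral>\<^sup>+p. \<integral>\<^sup>+q. ennreal (cmod (\<phi> p) * cmod (\<phi> q) * k (p - q)) \<partial>lborel \<partial>lborel) \<le> 2 * S"
    by (simp add: mult_2)
  then have "(\<integral>\<^sup>+p. \<integral>\<^sup>+q. ennreal (cmod (\<phi> p) * cmod (\<phi> q) * k (p - q)) \<partial>lborel \<partial>lborel) \<le> S"
    by (simp add: ennreal_mult_le_mult_iff)
  also have "S = (\<integral>\<^sup>+p. ennreal (norm p * (cmod (\<phi> p))\<^sup>2) * (\<integral>\<^sup>+q. ennreal (1 / norm q * k (p - q)) \<partial>lborel) \<partial>lborel)"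
    unfolding S_def A_def by (simp add: nn_integral_cmult)
  also have "\<dots> \<le> (\<integral>\<^sup>+p. ennreal (norm p * (cmod (\<phi> p))\<^sup>2) * ennreal (pi\<^sup>2 / \<beta>) \<partial>lborel)"
    unfolding k_def by (intro nn_integral_mono mult_left_mono nn_integral_shifted_inverse_radial \<beta>) auto
  also have "\<dots> = ennreal (pi\<^sup>2 / \<beta>) * (\<integral>\<^sup>+p. ennreal (norm p * (cmod (\<phi> p))\<^sup>2) \<partial>lborel)"
    by (simp add: nn_integral_cmult mult.commute)
  finally show ?thesis by (simp add: k_def)
qed

section \<open>The Bessel potential as a mixture of Gaussians\<close>

lemma cosh_borel_measurable [measurable]: "cosh \<in> borel_measurable (borel :: real measure)"
  unfolding cosh_def[abs_def] by measurable

lemma bessel_K_measurable [measurable]: "bessel_K \<nu> \<in> borel_measurable borel"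
  unfolding bessel_K_def set_lebesgue_integral_def by measurable

text \<open>Extend the integral over \<open>t\<close> to the line by symmetry and substitute \<open>t = u - ln x\<close>.\<close>

lemma bessel_K_0_le_gaussian_mixture:
  fixes x :: real
  assumes x: "x > 0"
  shows "ennreal (bessel_K 0 x)
    \<le> (\<integral>\<^sup>+u. ennreal (1/2 * exp (- exp u / 2) * exp (- (x\<^sup>2 * exp (- u) / 2))) \<partial>lborel)"
proof -
  define F where "F t = exp (- x * cosh t)" for t
  have [measurable]: "F \<in> borel_measurable borel" unfolding F_def by measurable
  define A where "A = (\<integral>\<^sup>+t. ennreal (F t) * indicator {0..} t \<partial>lborel)"
  define M where "M = (\<integral>\<^sup>+u. ennreal (exp (- exp u / 2) * exp (- (x\<^sup>2 * exp (- u) / 2))) \<partial>lborel)"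
  have "ennreal (bessel_K 0 x) = ennreal (LINT t|lborel. indicator {0..} t *\<^sub>R F t)"
    by (simp add: bessel_K_def set_lebesgue_integral_def F_def)
  also have "\<dots> \<le> ennreal (norm (LINT t|lborel. indicator {0..} t *\<^sub>R F t))"
    by (intro ennreal_leI) simp
  also have "\<dots> \<le> (\<integral>\<^sup>+t. ennreal (norm (indicator {0..} t *\<^sub>R F t)) \<partial>lborel)"
    by (rule norm_integral_le_nn_integral) measurable
  also have "\<dots> = A"
    unfolding A_def by (intro nn_integral_cong) (auto simp: F_def split: split_indicator)
  finally have bA: "ennreal (bessel_K 0 x) \<le> A" .
  have "A = (\<integral>\<^sup>+t. ennreal (F (0 - t)) * indicator {0..} (0 - t) \<partial>lborel)"
    unfolding A_def by (rule nn_integral_lborel_reflect[symmetric]) measurable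
  also have "\<dots> = (\<integral>\<^sup>+t. ennreal (F t) * indicator {..0} t \<partial>lborel)"
    by (intro nn_integral_cong) (auto simp: F_def split: split_indicator)
  finally have "A + A = (\<integral>\<^sup>+t. ennreal (F t) * indicator {0..} t + ennreal (F t) * indicator {..0} t \<partial>lborel)"
    by (subst nn_integral_add) (auto simp: A_def)
  also have "\<dots> = (\<integral>\<^sup>+t. ennreal (F t) \<partial>lborel)"
  proof (rule nn_integral_cong_AE)
    have "AE t in lborel. t \<noteq> (0::real)" by (rule AE_lborel_singleton)
    then show "AE t in lborel. ennreal (F t) * indicator {0..} t + ennreal (F t) * indicator {..0} t = ennreal (F t)"
      by eventually_elim (auto split: split_indicator)
  qed
  also have "\<dots> = (\<integral>\<^sup>+u. ennreal (F (- ln x + 1 * u)) \<partial>lborel)"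
    by (subst nn_integral_real_affine[where c=1 and t="- ln x"]) auto
  also have "\<dots> = M"
    unfolding M_def
  proof (intro nn_integral_cong arg_cong[where f=ennreal])
    fix u :: real
    \<comment> \<open>After the shift by \<open>ln x\<close> the variable \<open>x\<close> occurs
      only as \<open>x\<^sup>2\<close>, that is, in a Gaussian of rate
      \<open>exp (- u) / 2\<close>.\<close>
    have "x * cosh (- ln x + 1 * u) = exp u / 2 + x\<^sup>2 * exp (- u) / 2"
      using x by (simp add: cosh_def exp_add exp_minus exp_diff field_simps power2_eq_square)
    then show "F (- ln x + 1 * u) = exp (- exp u / 2) * exp (- (x\<^sup>2 * exp (- u) / 2))"
      by (simp add: F_def flip: exp_add)
  qed
  finally have "2 * A = M" by (simp add: mult_2)
  then have "ennreal (1/2) * M = ennreal (1/2) * ennreal 2 * A" by (simp add: mult.assoc)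
  also have "\<dots> = A" by (subst ennreal_mult[symmetric]) auto
  finally have "A = ennreal (1/2) * M" by simp
  also have "\<dots> = (\<integral>\<^sup>+u. ennreal (1/2 * exp (- exp u / 2) * exp (- (x\<^sup>2 * exp (- u) / 2))) \<partial>lborel)"
    unfolding M_def
    by (subst nn_integral_cmult[symmetric], measurable, intro nn_integral_cong,
        subst ennreal_mult[symmetric]) auto
  finally show ?thesis using bA by simp
qed

text \<open>In the variable v = exp u this is the integral of c exp(-k v) over the positive
  half-line.\<close>

lemma nn_integral_exp_exp:
  fixes k c :: real
  assumes k: "k > 0" and c: "c \<ge> 0"
  shows "(\<integral>\<^sup>+u. ennreal (c * (exp u * exp (- k * exp u))) \<partial>lborel) = ennreal (c / k)"
proof -
  define f where "f u = exp u * exp (- k * exp u)" for u :: real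
  define F where "F u = - exp (- k * exp u) / k" for u :: real
  have "DERIV F x :> f x" for x
    unfolding F_def f_def using k by (auto intro!: derivative_eq_intros)
  moreover have "isCont f x" for x unfolding f_def by (intro continuous_intros)
  moreover have f0: "f x \<ge> 0" for x by (simp add: f_def)
  moreover have "(F \<longlongrightarrow> - inverse k) at_bot" unfolding F_def using k by real_asymp
  moreover have "(F \<longlongrightarrow> 0) at_top" unfolding F_def using k by real_asymp
  ultimately have I: "set_integrable lborel (einterval (- \<infinity>) \<infinity>) f" "(LBINT x=-\<infinity>..\<infinity>. f x) = 0 - (- inverse k)"
    by (intro interval_integral_FTC_nonneg[where F=F]; simp add: ereal_tendsto_simps)+
  have int: "integrable lborel f" using I(1) by (simp add: set_integrable_def einterval_def)
  have "(LINT x|lborel. f x) = 1 / k"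
    using I(2) by (simp add: interval_lebesgue_integral_def set_lebesgue_integral_def einterval_def inverse_eq_divide)
  then have "(\<integral>\<^sup>+u. ennreal (c * f u) \<partial>lborel) = ennreal (c / k)"
    using int c f0 by (subst nn_integral_eq_integral) auto
  then show ?thesis by (simp add: f_def)
qed

text \<open>The result is the Fourier transform of K_0(beta |x|) in the plane, K_0(beta |x|) / (2
  pi) being the Green function of beta^2 - Laplacian. The prefactor pi/a of the planar Gaussian
  transform supplies the \<open>exp u\<close> that makes the integrand an exact derivative; the
  mixing density and the Gaussian merge into \<open>exp (- k * exp u)\<close>.\<close>

lemma gauss_hat_mixture:
  fixes w :: "real^2" and \<beta> :: real
  assumes \<beta>: "\<beta> > 0"
  shows "(\<integral>\<^sup>+u. ennreal (1/2 * exp (- exp u / 2)) * ennreal (gauss_hat (\<beta>\<^sup>2 * exp (- u) / 2) w) \<partial>lborel)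
    = ennreal (2 * pi * (1 / ((norm w)\<^sup>2 + \<beta>\<^sup>2)))"
proof -
  define k where "k = (1 + (norm w)\<^sup>2 / \<beta>\<^sup>2) / 2"
  have k: "k > 0" using \<beta> by (simp add: k_def add_pos_nonneg)
  have "1/2 * exp (- exp u / 2) * gauss_hat (\<beta>\<^sup>2 * exp (- u) / 2) w
      = (pi / \<beta>\<^sup>2) * (exp u * exp (- k * exp u))" for u
  proof -
    have "(norm w)\<^sup>2 / (4 * (\<beta>\<^sup>2 * exp (- u) / 2)) = (norm w)\<^sup>2 / \<beta>\<^sup>2 / 2 * exp u"
      using \<beta> by (simp add: exp_minus field_simps)
    then have "gauss_hat (\<beta>\<^sup>2 * exp (- u) / 2) w = pi / (\<beta>\<^sup>2 * exp (- u) / 2) * exp (- ((norm w)\<^sup>2 / \<beta>\<^sup>2 / 2 * exp u))"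
      using \<beta> by (simp add: gauss_hat_def)
    also have "pi / (\<beta>\<^sup>2 * exp (- u) / 2) = 2 * (pi / \<beta>\<^sup>2) * exp u"
      using \<beta> by (simp add: exp_minus field_simps)
    finally have "1/2 * exp (- exp u / 2) * gauss_hat (\<beta>\<^sup>2 * exp (- u) / 2) w
       = (pi / \<beta>\<^sup>2) * exp u * exp (- exp u / 2 + - ((norm w)\<^sup>2 / \<beta>\<^sup>2 / 2 * exp u))"
      by (simp only: exp_add) simp
    also have "- exp u / 2 + - ((norm w)\<^sup>2 / \<beta>\<^sup>2 / 2 * exp u) = - k * exp u"
      by (simp add: k_def field_simps)
    finally show ?thesis by simp
  qed
  moreover have "ennreal (1/2 * exp (- exp u / 2)) * ennreal (gauss_hat (\<beta>\<^sup>2 * exp (- u) / 2) w)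
      = ennreal (1/2 * exp (- exp u / 2) * gauss_hat (\<beta>\<^sup>2 * exp (- u) / 2) w)" for u
    using \<beta> by (subst ennreal_mult) auto
  ultimately have "(\<integral>\<^sup>+u. ennreal (1/2 * exp (- exp u / 2)) * ennreal (gauss_hat (\<beta>\<^sup>2 * exp (- u) / 2) w) \<partial>lborel)
     = (\<integral>\<^sup>+u. ennreal ((pi / \<beta>\<^sup>2) * (exp u * exp (- k * exp u))) \<partial>lborel)"
    by simp
  also have "\<dots> = ennreal (pi / \<beta>\<^sup>2 / k)"
    by (rule nn_integral_exp_exp[OF k]) simp
  also have "pi / \<beta>\<^sup>2 / k = 2 * pi * (1 / ((norm w)\<^sup>2 + \<beta>\<^sup>2))"
    using \<beta> by (simp add: k_def field_simps add_pos_nonneg)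
  finally show ?thesis .
qed

text \<open>The assumption is linear in the Gaussian weight, so it can be integrated against the
  mixing density \<open>m\<close>. All integrands are nonnegative and Tonelli moves the integral
  over \<open>u\<close> innermost, where it produces the Schur kernel.\<close>

lemma bessel_potential_le_of_gaussian:
  fixes \<psi> \<phi> :: "real^2 \<Rightarrow> complex" and \<beta> :: real
  assumes [measurable]: "\<psi> \<in> borel_measurable borel" "\<phi> \<in> borel_measurable borel"
    and \<beta>: "\<beta> > 0"
    and gw: "\<And>a. a > 0 \<Longrightarrow>
      ennreal ((2 * pi) ^ 4) * (\<integral>\<^sup>+x. ennreal (exp (- a * (norm x)\<^sup>2) * (cmod (\<psi> x))\<^sup>2) \<partial>lborel)
        \<le> (\<integral>\<^sup>+p. \<integral>\<^sup>+q. ennreal (cmod (\<phi> p) * cmod (\<phi> q) * gauss_hat a (p - q)) \<partial>lborel \<partial>lborel)"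
  shows "ennreal ((2 * pi) ^ 4) * (\<integral>\<^sup>+x. ennreal (bessel_K 0 (\<beta> * norm x) * (cmod (\<psi> x))\<^sup>2) \<partial>lborel)
     \<le> ennreal (2 * pi * (pi\<^sup>2 / \<beta>)) * (\<integral>\<^sup>+p. ennreal (norm p * (cmod (\<phi> p))\<^sup>2) \<partial>lborel)"
proof -
  define m where "m u = ennreal (1/2 * exp (- exp u / 2))" for u :: real
  \<comment> \<open>The Gaussian rate in |x| when the argument of the Bessel function is
    \<open>\<beta> * norm x\<close>.\<close>
  define a where "a u = \<beta>\<^sup>2 * exp (- u) / 2" for u :: real
  have a: "a u > 0" for u using \<beta> by (simp add: a_def)
  have [measurable]: "m \<in> borel_measurable borel" "a \<in> borel_measurable borel"
    unfolding m_def a_def by measurable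
  define f where "f p q = ennreal (cmod (\<phi> p) * cmod (\<phi> q))" for p q
  have [measurable]: "case_prod f \<in> borel_measurable (borel \<Otimes>\<^sub>M borel)" unfolding f_def by measurable
  define H where "H u w = m u * ennreal (gauss_hat (a u) (w::real^2))" for u w
  have [measurable]: "case_prod H \<in> borel_measurable (borel \<Otimes>\<^sub>M borel)"
    unfolding H_def gauss_hat_def by measurable
  have "(\<integral>\<^sup>+x. ennreal (bessel_K 0 (\<beta> * norm x) * (cmod (\<psi> x))\<^sup>2) \<partial>lborel)
      \<le> (\<integral>\<^sup>+x. \<integral>\<^sup>+u. m u * ennreal (exp (- a u * (norm x)\<^sup>2) * (cmod (\<psi> x))\<^sup>2) \<partial>lborel \<partial>lborel)"
  proof (rule nn_integral_mono_AE)
    \<comment> \<open>The mixture bound is for positive arguments only; at the origin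
      \<open>bessel_K\<close> has a default value.\<close>
    have "AE x in lborel. x \<noteq> (0::real^2)" by (rule AE_lborel_singleton)
    then show "AE x in lborel. ennreal (bessel_K 0 (\<beta> * norm x) * (cmod (\<psi> x))\<^sup>2)
       \<le> (\<integral>\<^sup>+u. m u * ennreal (exp (- a u * (norm x)\<^sup>2) * (cmod (\<psi> x))\<^sup>2) \<partial>lborel)"
    proof eventually_elim
      case (elim x)
      have "ennreal (bessel_K 0 (\<beta> * norm x) * (cmod (\<psi> x))\<^sup>2)
          = ennreal (bessel_K 0 (\<beta> * norm x)) * ennreal ((cmod (\<psi> x))\<^sup>2)"
        by (rule ennreal_mult'') simp
      also have "\<dots> \<le> (\<integral>\<^sup>+u. ennreal (1/2 * exp (- exp u / 2) * exp (- ((\<beta> * norm x)\<^sup>2 * exp (- u) / 2))) \<partial>lborel)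
          * ennreal ((cmod (\<psi> x))\<^sup>2)"
        using elim \<beta> by (intro mult_right_mono bessel_K_0_le_gaussian_mixture) auto
      also have "\<dots> = (\<integral>\<^sup>+u. ennreal (1/2 * exp (- exp u / 2) * exp (- ((\<beta> * norm x)\<^sup>2 * exp (- u) / 2)))
          * ennreal ((cmod (\<psi> x))\<^sup>2) \<partial>lborel)"
        by (rule nn_integral_multc[symmetric]) measurable
      also have "\<dots> = (\<integral>\<^sup>+u. m u * ennreal (exp (- a u * (norm x)\<^sup>2) * (cmod (\<psi> x))\<^sup>2) \<partial>lborel)"
        by (intro nn_integral_cong)
           (simp add: m_def a_def power_mult_distrib mult_ac flip: ennreal_mult')
      finally show ?case .
    qed
  qed
  also have "\<dots> = (\<integral>\<^sup>+u. \<integral>\<^sup>+x. m u * ennreal (exp (- a u * (norm x)\<^sup>2) * (cmod (\<psi> x))\<^sup>2) \<partial>lborel \<partial>lborel)"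
    by (rule lborel_pair.Fubini') measurable
  also have "\<dots> = (\<integral>\<^sup>+u. m u * (\<integral>\<^sup>+x. ennreal (exp (- a u * (norm x)\<^sup>2) * (cmod (\<psi> x))\<^sup>2) \<partial>lborel) \<partial>lborel)"
    by (simp add: nn_integral_cmult)
  finally have "ennreal ((2 * pi) ^ 4) * (\<integral>\<^sup>+x. ennreal (bessel_K 0 (\<beta> * norm x) * (cmod (\<psi> x))\<^sup>2) \<partial>lborel)
     \<le> ennreal ((2 * pi) ^ 4) * (\<integral>\<^sup>+u. m u * (\<integral>\<^sup>+x. ennreal (exp (- a u * (norm x)\<^sup>2) * (cmod (\<psi> x))\<^sup>2) \<partial>lborel) \<partial>lborel)"
    by (rule mult_left_mono) simp
  also have "\<dots> = (\<integral>\<^sup>+u. m u * (ennreal ((2 * pi) ^ 4) * (\<integral>\<^sup>+x. ennreal (exp (- a u * (norm x)\<^sup>2) * (cmod (\<psi> x))\<^sup>2) \<partial>lborel)) \<partial>lborel)"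
    by (subst nn_integral_cmult[symmetric]) (auto simp: mult.left_commute)
  also have "\<dots> \<le> (\<integral>\<^sup>+u. m u * (\<integral>\<^sup>+p. \<integral>\<^sup>+q. ennreal (cmod (\<phi> p) * cmod (\<phi> q) * gauss_hat (a u) (p - q)) \<partial>lborel \<partial>lborel) \<partial>lborel)"
    by (intro nn_integral_mono mult_left_mono gw a) auto
  also have "\<dots> = (\<integral>\<^sup>+u. \<integral>\<^sup>+p. \<integral>\<^sup>+q. f p q * H u (p - q) \<partial>lborel \<partial>lborel \<partial>lborel)"
  proof (rule nn_integral_cong)
    fix u :: real
    have "m u * (\<integral>\<^sup>+p. \<integral>\<^sup>+q. ennreal (cmod (\<phi> p) * cmod (\<phi> q) * gauss_hat (a u) (p - q)) \<partial>lborel \<partial>lborel)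
      = (\<integral>\<^sup>+p. \<integral>\<^sup>+q. m u * ennreal (cmod (\<phi> p) * cmod (\<phi> q) * gauss_hat (a u) (p - q)) \<partial>lborel \<partial>lborel)"
      by (simp add: nn_integral_cmult)
    also have "\<dots> = (\<integral>\<^sup>+p. \<integral>\<^sup>+q. f p q * H u (p - q) \<partial>lborel \<partial>lborel)"
      by (intro nn_integral_cong) (simp add: f_def H_def ennreal_mult'' a mult.left_commute)
    finally show "m u * (\<integral>\<^sup>+p. \<integral>\<^sup>+q. ennreal (cmod (\<phi> p) * cmod (\<phi> q) * gauss_hat (a u) (p - q)) \<partial>lborel \<partial>lborel)
      = (\<integral>\<^sup>+p. \<integral>\<^sup>+q. f p q * H u (p - q) \<partial>lborel \<partial>lborel)" .
  qed
  also have "\<dots> = (\<integral>\<^sup>+p. \<integral>\<^sup>+u. \<integral>\<^sup>+q. f p q * H u (p - q) \<partial>lborel \<partial>lborel \<partial>lborel)"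
    by (rule lborel_pair.Fubini') measurable
  also have "\<dots> = (\<integral>\<^sup>+p. \<integral>\<^sup>+q. \<integral>\<^sup>+u. f p q * H u (p - q) \<partial>lborel \<partial>lborel \<partial>lborel)"
    by (intro nn_integral_cong lborel_pair.Fubini') measurable
  also have "\<dots> = (\<integral>\<^sup>+p. \<integral>\<^sup>+q. f p q * ennreal (2 * pi * (1 / ((norm (p - q))\<^sup>2 + \<beta>\<^sup>2))) \<partial>lborel \<partial>lborel)"
  proof (intro nn_integral_cong)
    fix p q
    have "(\<integral>\<^sup>+u. f p q * H u (p - q) \<partial>lborel) = f p q * (\<integral>\<^sup>+u. H u (p - q) \<partial>lborel)"
      by (rule nn_integral_cmult) measurable
    then show "(\<integral>\<^sup>+u. f p q * H u (p - q) \<partial>lborel) = f p q * ennreal (2 * pi * (1 / ((norm (p - q))\<^sup>2 + \<beta>\<^sup>2)))"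
      unfolding H_def m_def a_def by (simp only: gauss_hat_mixture[OF \<beta>])
  qed
  also have "\<dots> = (\<integral>\<^sup>+p. \<integral>\<^sup>+q. ennreal (2 * pi) * ennreal (cmod (\<phi> p) * cmod (\<phi> q) * (1 / ((norm (p - q))\<^sup>2 + \<beta>\<^sup>2))) \<partial>lborel \<partial>lborel)"
    unfolding f_def by (intro nn_integral_cong) (simp add: mult_ac flip: ennreal_mult'')
  also have "\<dots> = ennreal (2 * pi) * (\<integral>\<^sup>+p. \<integral>\<^sup>+q. ennreal (cmod (\<phi> p) * cmod (\<phi> q) * (1 / ((norm (p - q))\<^sup>2 + \<beta>\<^sup>2))) \<partial>lborel \<partial>lborel)"
    by (simp add: nn_integral_cmult del: times_divide_eq_right mult_1_right)
  also have "\<dots> \<le> ennreal (2 * pi) * (ennreal (pi\<^sup>2 / \<beta>) * (\<integral>\<^sup>+p. ennreal (norm p * (cmod (\<phi> p))\<^sup>2) \<partial>lborel))"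
    by (intro mult_left_mono Schur_test_inverse_norm \<beta>) auto
  also have "\<dots> = ennreal (2 * pi * (pi\<^sup>2 / \<beta>)) * (\<integral>\<^sup>+p. ennreal (norm p * (cmod (\<phi> p))\<^sup>2) \<partial>lborel)"
    using \<beta> by (simp add: mult.assoc[symmetric] flip: ennreal_mult')
  finally show ?thesis .
qed

section \<open>Comparison of the coupling constants\<close>

text \<open>Gamma increases from 2 to 9/4, so Gamma(9/4) >= Gamma(2) = 1, and two steps of the
  functional equation give Gamma(9/4) = (5/16) Gamma(1/4).\<close>

lemma Gamma_quarter_ge: "Gamma (1/4 :: real) \<ge> 3.2"
proof -
  have nonpos: "x \<notin> \<int>\<^sub>\<le>\<^sub>0" if "x > 0" for x :: real
    using that by (auto elim!: nonpos_Ints_cases)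
  have "Gamma (2 :: real) < Gamma (9/4)" by (rule Gamma_real_strict_mono) auto
  then have "Gamma (9/4 :: real) \<ge> 1" by (simp add: Gamma_numeral)
  moreover have "Gamma (9/4 :: real) = 5/4 * Gamma (5/4)"
    using Gamma_plus1[of "5/4 :: real"] by (simp add: nonpos)
  moreover have "Gamma (5/4 :: real) = 1/4 * Gamma (1/4)"
    using Gamma_plus1[of "1/4 :: real"] by (simp add: nonpos)
  ultimately show ?thesis by simp
qed

text \<open>In units of hbar c beta the two constants are about 0.30 and 0.64, so crude decimal
  bounds suffice: 3.2 for pi, 1.8 for the root of e (from e <= 3) and 2.6 for the root of
  6.4.\<close>

lemma gamma_crit_le:
  assumes "hbar > 0" "c > 0" "\<beta> > 0"
  shows "gamma_crit hbar c \<beta> \<le> 2 / pi * hbar * c * \<beta>"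
proof -
  have pi: "pi \<le> 3.2" "0 < pi" using pi_approx by auto
  have "exp (1/2 :: real) ^ 2 = exp 1" by (simp flip: exp_of_nat_mult)
  also have "\<dots> \<le> (1.8)\<^sup>2" using exp_le by (simp add: power2_eq_square)
  finally have e: "exp (1/2 :: real) \<le> 1.8" by (rule power2_le_imp_le) simp
  have "(2 * pi) powr (3/2) = (2 * pi) powr (1 + 1/2)" by simp
  also have "\<dots> = 2 * pi * sqrt (2 * pi)" using pi by (simp only: powr_add powr_half_sqrt) simp
  also have "\<dots> \<le> 6.4 * 2.6"
    using pi by (intro mult_mono real_le_lsqrt) (auto simp: power2_eq_square)
  finally have p: "(2 * pi) powr (3/2) \<le> 16.64" by simp
  have "pi * (2 * pi) powr (3/2) * exp (1/2) \<le> 3.2 * 16.64 * 1.8"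
    using pi p e by (intro mult_mono) auto
  also have "\<dots> \<le> (3.2 :: real) ^ 4" by (simp add: power4_eq_xxxx)
  also have "\<dots> \<le> Gamma (1/4 :: real) ^ 4" using Gamma_quarter_ge by (intro power_mono) auto
  finally have "pi * (2 * pi) powr (3/2) * exp (1/2) \<le> Gamma (1/4 :: real) ^ 4" .
  moreover have "Gamma (1/4 :: real) ^ 4 > 0" using Gamma_quarter_ge by (intro zero_less_power) linarith
  ultimately have "2 * (2 * pi) powr (3/2) * exp (1/2) / Gamma (1/4 :: real) ^ 4 \<le> 2 / pi"
    using pi(2) by (simp add: field_simps)
  then show ?thesis unfolding gamma_crit_def using assms by (intro mult_right_mono) auto
qed

section \<open>The Fourier transform on square-integrable functions\<close>

text \<open>The forms are integrals over \<open>lebesgue\<close>, while the Fubini arguments run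
  over \<open>lborel\<close>; Borel representatives connect the two.\<close>

lemma completion_ex_borel_measurable_complex:
  fixes f :: "'a \<Rightarrow> complex"
  assumes f: "f \<in> borel_measurable (completion M)"
  shows "\<exists>g\<in>borel_measurable M. AE x in M. f x = g x"
proof -
  have "(\<lambda>x. Re (f x)) \<in> borel_measurable (completion M)" "(\<lambda>x. Im (f x)) \<in> borel_measurable (completion M)"
    using f by (auto intro: borel_measurable_Re borel_measurable_Im measurable_compose)
  from this[THEN completion_ex_borel_measurable_real]
  obtain g h where [measurable]: "g \<in> borel_measurable M" "h \<in> borel_measurable M"
    and AE: "AE x in M. Re (f x) = g x" "AE x in M. Im (f x) = h x" by blast
  have "AE x in M. f x = complex_of_real (g x) + \<i> * complex_of_real (h x)"
    using AE by eventually_elim (simp add: complex_eq_iff)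
  then show ?thesis by (intro bexI) measurable
qed

lemma fourier_integral_cong_AE:
  assumes "\<psi> \<in> borel_measurable lebesgue" "\<psi>' \<in> borel_measurable lebesgue"
    and "AE x in lebesgue. \<psi> x = \<psi>' x"
  shows "fourier_integral h \<psi> p = fourier_integral h \<psi>' p"
proof -
  have "(\<lambda>x. exp (\<i> * complex_of_real ((p \<bullet> x) / h))) \<in> borel_measurable lebesgue"
    by (intro measurable_completion) measurable
  moreover have "AE x in lebesgue. exp (\<i> * complex_of_real ((p \<bullet> x) / h)) * \<psi> x
      = exp (\<i> * complex_of_real ((p \<bullet> x) / h)) * \<psi>' x"
    using assms(3) by eventually_elim simp
  ultimately show ?thesis
    unfolding fourier_integral_def using assms(1,2)
    by (intro integral_cong_AE borel_measurable_times)
qed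

lemma cball_sets_borel [measurable]: "cball (a::'a::metric_space) r \<in> sets borel"
  by simp

text \<open>Stated as equality of predicates because \<open>fourier_transform\<close> applies
  \<open>SOME\<close> to this predicate: representatives that agree almost everywhere then receive
  the same choice.\<close>

lemma is_fourier_transform_cong_AE:
  assumes [measurable]: "\<psi> \<in> borel_measurable lebesgue" "\<psi>' \<in> borel_measurable lebesgue"
    and eq: "AE x in lebesgue. \<psi> x = \<psi>' x"
  shows "is_fourier_transform h \<psi> = is_fourier_transform h \<psi>'"
proof -
  have "fourier_integral h (\<lambda>x. indicator (cball 0 R) x *\<^sub>R \<psi> x) p
      = fourier_integral h (\<lambda>x. indicator (cball 0 R) x *\<^sub>R \<psi>' x) p" for R p
  proof (rule fourier_integral_cong_AE)
    show "AE x in lebesgue. indicator (cball 0 R) x *\<^sub>R \<psi> x = indicator (cball 0 R) x *\<^sub>R \<psi>' x"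
      using eq by eventually_elim simp
  qed (auto intro!: borel_measurable_scaleR borel_measurable_indicator)
  then show ?thesis unfolding is_fourier_transform_def by presburger
qed

lemma L2_cong_AE:
  assumes "\<phi> \<in> L2" "\<phi>' \<in> borel_measurable lebesgue" "AE p in lebesgue. \<phi> p = \<phi>' p"
  shows "\<phi>' \<in> L2"
proof -
  have "integrable lebesgue (\<lambda>x. (cmod (\<phi>' x))\<^sup>2)"
  proof (rule Bochner_Integration.integrable_cong_AE_imp)
    show "integrable lebesgue (\<lambda>x. (cmod (\<phi> x))\<^sup>2)" using assms(1) by (simp add: L2_def)
    show "(\<lambda>x. (cmod (\<phi>' x))\<^sup>2) \<in> borel_measurable lebesgue" using assms(2) by measurable
    show "AE x in lebesgue. (cmod (\<phi> x))\<^sup>2 = (cmod (\<phi>' x))\<^sup>2"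
      using assms(3) by eventually_elim simp
  qed
  then show ?thesis using assms(2) by (simp add: L2_def)
qed

lemma is_fourier_transform_cong_AE_right:
  assumes ft: "is_fourier_transform h \<psi> \<phi>" and m: "\<phi>' \<in> borel_measurable lebesgue"
    and eq: "AE p in lebesgue. \<phi> p = \<phi>' p"
  shows "is_fourier_transform h \<psi> \<phi>'"
proof -
  have "(\<integral>\<^sup>+ p. ennreal ((cmod (\<phi> p - fourier_integral h (\<lambda>x. indicator (cball 0 R) x *\<^sub>R \<psi> x) p))\<^sup>2) \<partial>lebesgue)
     = (\<integral>\<^sup>+ p. ennreal ((cmod (\<phi>' p - fourier_integral h (\<lambda>x. indicator (cball 0 R) x *\<^sub>R \<psi> x) p))\<^sup>2) \<partial>lebesgue)" for R
  proof (rule nn_integral_cong_AE)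
    show "AE p in lebesgue. ennreal ((cmod (\<phi> p - fourier_integral h (\<lambda>x. indicator (cball 0 R) x *\<^sub>R \<psi> x) p))\<^sup>2)
       = ennreal ((cmod (\<phi>' p - fourier_integral h (\<lambda>x. indicator (cball 0 R) x *\<^sub>R \<psi> x) p))\<^sup>2)"
      using eq by eventually_elim simp
  qed
  then show ?thesis
    using ft m eq L2_cong_AE[of \<phi> \<phi>'] by (simp add: is_fourier_transform_def)
qed

text \<open>Fixed at \<open>hbar = 1\<close> and taken over \<open>lborel\<close>, so that it is
  Borel measurable in \<open>p\<close>; the other values of \<open>hbar\<close> are dilates of
  it.\<close>

definition truncated_transform :: "(real^2 \<Rightarrow> complex) \<Rightarrow> real \<Rightarrow> real^2 \<Rightarrow> complex" where
  "truncated_transform \<psi> R p = (LINT x|lborel. iexp (p \<bullet> x) * (indicator (cball 0 R) x *\<^sub>R \<psi> x))"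

lemma truncated_transform_measurable [measurable]:
  assumes [measurable]: "\<psi> \<in> borel_measurable borel"
  shows "truncated_transform \<psi> R \<in> borel_measurable borel"
  unfolding truncated_transform_def by measurable

lemma fourier_integral_truncated:
  assumes [measurable]: "\<psi> \<in> borel_measurable borel"
  shows "fourier_integral h (\<lambda>x. indicator (cball 0 R) x *\<^sub>R \<psi> x) p = truncated_transform \<psi> R (p /\<^sub>R h)"
  unfolding fourier_integral_def truncated_transform_def
  by (subst integral_completion) (auto simp: divide_inverse mult.commute)

lemma is_fourier_transform_iff_borel:
  assumes [measurable]: "\<psi> \<in> borel_measurable borel"
  shows "is_fourier_transform h \<psi> \<phi> \<longleftrightarrow> \<phi> \<in> L2 \<and>
     ((\<lambda>R. \<integral>\<^sup>+ p. ennreal ((cmod (\<phi> p - truncated_transform \<psi> R (p /\<^sub>R h)))\<^sup>2) \<partial>lborel) \<longlongrightarrow> 0) at_top"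
  by (simp add: is_fourier_transform_def fourier_integral_truncated nn_integral_completion)

text \<open>Uniqueness of limits in mean square. It identifies the function picked by
  \<open>SOME\<close> with any transform that has been constructed explicitly.\<close>

lemma is_fourier_transform_unique:
  assumes [measurable]: "\<psi> \<in> borel_measurable borel"
    and ft: "is_fourier_transform h \<psi> \<phi>\<^sub>1" "is_fourier_transform h \<psi> \<phi>\<^sub>2"
  shows "AE p in lebesgue. \<phi>\<^sub>1 p = \<phi>\<^sub>2 p"
proof -
  have [measurable]: "\<phi>\<^sub>1 \<in> borel_measurable lebesgue" "\<phi>\<^sub>2 \<in> borel_measurable lebesgue"
    using ft by (auto simp: is_fourier_transform_def L2_def)
  define F where "F R p = truncated_transform \<psi> R (p /\<^sub>R h)" for R p
  have [measurable]: "F R \<in> borel_measurable lebesgue" for R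
    unfolding F_def by (intro measurable_completion) measurable
  define D where "D \<phi> = (\<lambda>R. \<integral>\<^sup>+ p. ennreal ((cmod (\<phi> p - F R p))\<^sup>2) \<partial>lebesgue)" for \<phi>
  have D: "(D \<phi>\<^sub>1 \<longlongrightarrow> 0) at_top" "(D \<phi>\<^sub>2 \<longlongrightarrow> 0) at_top"
    using ft by (simp_all add: is_fourier_transform_iff_borel D_def F_def nn_integral_completion)
  have bound: "(\<integral>\<^sup>+ p. ennreal ((cmod (\<phi>\<^sub>1 p - \<phi>\<^sub>2 p))\<^sup>2) \<partial>lebesgue) \<le> 2 * D \<phi>\<^sub>1 R + 2 * D \<phi>\<^sub>2 R" for R
  proof -
    have "(\<integral>\<^sup>+ p. ennreal ((cmod (\<phi>\<^sub>1 p - \<phi>\<^sub>2 p))\<^sup>2) \<partial>lebesgue)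
        \<le> (\<integral>\<^sup>+ p. 2 * ennreal ((cmod (\<phi>\<^sub>1 p - F R p))\<^sup>2) + 2 * ennreal ((cmod (\<phi>\<^sub>2 p - F R p))\<^sup>2) \<partial>lebesgue)"
    proof (rule nn_integral_mono)
      fix p
      have "(cmod (\<phi>\<^sub>1 p - \<phi>\<^sub>2 p))\<^sup>2 \<le> 2 * (cmod (\<phi>\<^sub>1 p - F R p))\<^sup>2 + 2 * (cmod (\<phi>\<^sub>2 p - F R p))\<^sup>2"
        using norm_sq_le_twice_diff[of "\<phi>\<^sub>1 p - \<phi>\<^sub>2 p" "F R p - \<phi>\<^sub>2 p"]
        by (simp add: norm_minus_commute)
      from ennreal_leI[OF this]
      show "ennreal ((cmod (\<phi>\<^sub>1 p - \<phi>\<^sub>2 p))\<^sup>2)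
          \<le> 2 * ennreal ((cmod (\<phi>\<^sub>1 p - F R p))\<^sup>2) + 2 * ennreal ((cmod (\<phi>\<^sub>2 p - F R p))\<^sup>2)"
        by (simp add: ennreal_mult')
    qed
    also have "\<dots> = 2 * D \<phi>\<^sub>1 R + 2 * D \<phi>\<^sub>2 R"
      unfolding D_def by (subst nn_integral_add) (auto simp: nn_integral_cmult)
    finally show ?thesis .
  qed
  have "((\<lambda>R. 2 * D \<phi>\<^sub>1 R + 2 * D \<phi>\<^sub>2 R) \<longlongrightarrow> 2 * 0 + 2 * 0) at_top"
    by (intro tendsto_add ennreal_tendsto_cmult D) auto
  then have "(\<integral>\<^sup>+ p. ennreal ((cmod (\<phi>\<^sub>1 p - \<phi>\<^sub>2 p))\<^sup>2) \<partial>lebesgue) \<le> 2 * 0 + 2 * 0"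
    by (rule tendsto_lowerbound) (auto simp: bound)
  then have "AE p in lebesgue. ennreal ((cmod (\<phi>\<^sub>1 p - \<phi>\<^sub>2 p))\<^sup>2) = 0"
    by (subst nn_integral_0_iff_AE[symmetric]) auto
  then show ?thesis by eventually_elim simp
qed

lemma nn_integral_lborel_scale:
  fixes F :: "'a::euclidean_space \<Rightarrow> ennreal"
  assumes [measurable]: "F \<in> borel_measurable borel" and h: "h > 0"
  shows "(\<integral>\<^sup>+p. F (p /\<^sub>R h) \<partial>lborel) = ennreal (h ^ DIM('a)) * (\<integral>\<^sup>+p. F p \<partial>lborel)"
proof -
  have "lborel = density (distr lborel borel (\<lambda>x::'a. h *\<^sub>R x)) (\<lambda>_. ennreal (h ^ DIM('a)))"
    using lborel_affine[of h "0::'a"] h by (simp add: ennreal_power)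
  then have "(\<integral>\<^sup>+p. F (p /\<^sub>R h) \<partial>lborel)
      = (\<integral>\<^sup>+p. F (p /\<^sub>R h) \<partial>density (distr lborel borel (\<lambda>x::'a. h *\<^sub>R x)) (\<lambda>_. ennreal (h ^ DIM('a))))"
    by (rule arg_cong)
  also have "\<dots> = ennreal (h ^ DIM('a)) * (\<integral>\<^sup>+p. F p \<partial>lborel)"
    using h by (subst nn_integral_density) (auto simp: nn_integral_distr nn_integral_cmult)
  finally show ?thesis .
qed

text \<open>Membership in \<open>H_half\<close> supplies a transform for \<open>hbar = 1\<close>
  only. Its dilate is the witness for the \<open>SOME\<close> in \<open>fourier_transform\<close> at
  every positive \<open>hbar\<close>.\<close>

lemma is_fourier_transform_scale:
  assumes [measurable]: "\<psi> \<in> borel_measurable borel" "\<phi> \<in> borel_measurable borel"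
    and h: "h > 0" and ft: "is_fourier_transform 1 \<psi> \<phi>"
  shows "is_fourier_transform h \<psi> (\<lambda>p. \<phi> (p /\<^sub>R h))"
  unfolding is_fourier_transform_iff_borel[OF assms(1)]
proof
  have "integrable lborel (\<lambda>p. (cmod (\<phi> p))\<^sup>2)"
    using ft by (simp add: is_fourier_transform_def L2_def integrable_completion)
  then have "(\<integral>\<^sup>+p. ennreal ((cmod (\<phi> p))\<^sup>2) \<partial>lborel) < \<infinity>"
    by (simp add: integrable_iff_bounded)
  then have "(\<integral>\<^sup>+p. ennreal ((cmod (\<phi> (p /\<^sub>R h)))\<^sup>2) \<partial>lborel) < \<infinity>"
    by (subst nn_integral_lborel_scale[OF _ h, of "\<lambda>p. ennreal ((cmod (\<phi> p))\<^sup>2)"])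
       (auto simp: ennreal_mult_less_top)
  then have "integrable lborel (\<lambda>p. (cmod (\<phi> (p /\<^sub>R h)))\<^sup>2)"
    by (intro integrableI_bounded) auto
  then show "(\<lambda>p. \<phi> (p /\<^sub>R h)) \<in> L2"
    by (auto simp: L2_def integrable_completion intro!: measurable_completion)
  have "((\<lambda>R. ennreal (h ^ DIM(real^2)) * (\<integral>\<^sup>+ p. ennreal ((cmod (\<phi> p - truncated_transform \<psi> R p))\<^sup>2) \<partial>lborel))
      \<longlongrightarrow> ennreal (h ^ DIM(real^2)) * 0) at_top"
    using ft by (intro ennreal_tendsto_cmult) (auto simp: is_fourier_transform_iff_borel)
  moreover have "ennreal (h ^ DIM(real^2)) * (\<integral>\<^sup>+ p. ennreal ((cmod (\<phi> p - truncated_transform \<psi> R p))\<^sup>2) \<partial>lborel)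
      = (\<integral>\<^sup>+ p. ennreal ((cmod (\<phi> (p /\<^sub>R h) - truncated_transform \<psi> R (p /\<^sub>R h)))\<^sup>2) \<partial>lborel)" for R
    by (rule nn_integral_lborel_scale[symmetric, OF _ h]) measurable
  ultimately show "((\<lambda>R. \<integral>\<^sup>+ p. ennreal ((cmod (\<phi> (p /\<^sub>R h) - truncated_transform \<psi> R (p /\<^sub>R h)))\<^sup>2) \<partial>lborel) \<longlongrightarrow> 0) at_top"
    by simp
qed

section \<open>Fourier inversion with Gaussian damping\<close>

text \<open>Halving the rate recentres the Gaussian at the origin, at the price of a constant
  depending on \<open>z\<close>. The result has the form that is integrable against a
  square-integrable function.\<close>

lemma gauss_hat_le_gaussian:
  assumes e: "\<epsilon> > 0"
  shows "gauss_hat \<epsilon> (x - z) \<le> (sqrt (pi / \<epsilon>) ^ DIM('a) * exp ((norm z)\<^sup>2 / (4 * \<epsilon>))) * exp (- (1 / (8 * \<epsilon>)) * (norm (x::'a::euclidean_space))\<^sup>2)"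
proof -
  have "(norm x)\<^sup>2 / (8 * \<epsilon>) \<le> (2 * (norm (x - z))\<^sup>2 + 2 * (norm z)\<^sup>2) / (8 * \<epsilon>)"
    using e by (intro divide_right_mono norm_sq_le_twice_diff) auto
  also have "\<dots> = (norm (x - z))\<^sup>2 / (4 * \<epsilon>) + (norm z)\<^sup>2 / (4 * \<epsilon>)"
    by (simp add: add_divide_distrib)
  finally have "exp (- (norm (x - z))\<^sup>2 / (4 * \<epsilon>)) \<le> exp ((norm z)\<^sup>2 / (4 * \<epsilon>) + - (1 / (8 * \<epsilon>)) * (norm x)\<^sup>2)"
    by simp
  also have "\<dots> = exp ((norm z)\<^sup>2 / (4 * \<epsilon>)) * exp (- (1 / (8 * \<epsilon>)) * (norm x)\<^sup>2)"
    by (rule exp_add)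
  finally show ?thesis
    unfolding gauss_hat_def mult.assoc using e by (intro mult_left_mono) auto
qed

text \<open>For truncations of \<open>\<psi>\<close> to balls this is the multiplication formula,
  with the Gaussian transformed explicitly. As the radius grows, the position side converges by
  dominated convergence. The momentum side converges by Cauchy-Schwarz, since the truncated
  transforms converge in mean square and \<open>\<eta>\<close> is square-integrable.\<close>

lemma gaussian_regularized_inversion:
  fixes \<psi> \<phi> :: "real^2 \<Rightarrow> complex"
  assumes [measurable]: "\<psi> \<in> borel_measurable borel" "\<phi> \<in> borel_measurable borel"
    and \<psi>: "integrable lborel (\<lambda>x. (cmod (\<psi> x))\<^sup>2)"
    and ft: "is_fourier_transform 1 \<psi> \<phi>" and e: "\<epsilon> > 0"
  shows "(LINT p|lborel. (\<phi> p * complex_of_real (exp (- \<epsilon> * (norm p)\<^sup>2))) * iexp (- (p \<bullet> z)))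
       = (LINT x|lborel. \<psi> x * complex_of_real (gauss_hat \<epsilon> (x - z)))"
proof -
  define \<eta> where "\<eta> p = complex_of_real (exp (- \<epsilon> * (norm p)\<^sup>2)) * iexp (- (p \<bullet> z))" for p
  have [measurable]: "\<eta> \<in> borel_measurable borel" unfolding \<eta>_def by measurable
  have n\<eta>: "cmod (\<eta> p) = exp (- \<epsilon> * (norm p)\<^sup>2)" for p by (simp add: \<eta>_def norm_mult)
  have \<eta>: "integrable lborel \<eta>"
    by (rule Bochner_Integration.integrable_bound[OF integrable_gaussian[OF e]]) (auto simp: n\<eta>)
  define T where "T n = truncated_transform \<psi> (real n)" for n
  have [measurable]: "T n \<in> borel_measurable borel" for n unfolding T_def by measurable
  define f where "f n x = indicator (cball 0 (real n)) x *\<^sub>R \<psi> x" for n x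
  have [measurable]: "f n \<in> borel_measurable borel" for n unfolding f_def by measurable
  have f: "integrable lborel (f n)" for n
  proof (rule Bochner_Integration.integrable_bound)
    show "integrable lborel (\<lambda>x. indicator (cball 0 (real n)) x + (cmod (\<psi> x))\<^sup>2)"
      using \<psi> by (intro Bochner_Integration.integrable_add) (auto intro!: integrable_real_indicator simp: emeasure_cball)
    have "t \<le> 1 + t\<^sup>2" if "t \<ge> 0" for t :: real
      using sum_squares_bound[of t 1] that unfolding one_power2 mult_1_right by linarith
    then show "AE x in lborel. norm (f n x) \<le> norm (indicator (cball 0 (real n)) x + (cmod (\<psi> x))\<^sup>2)"
      by (auto simp: f_def split: split_indicator)
  qed measurable
  have Tf: "T n p = (LINT x|lborel. iexp (p \<bullet> x) * f n x)" for n p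
    by (simp add: T_def f_def truncated_transform_def)
  have \<eta>hat: "(LINT p|lborel. iexp (p \<bullet> x) * \<eta> p) = complex_of_real (gauss_hat \<epsilon> (x - z))" for x
  proof -
    have "iexp (p \<bullet> x) * iexp (- (p \<bullet> z)) = iexp ((x - z) \<bullet> p)" for p
      by (simp add: inner_diff_right inner_commute[of _ p] right_diff_distrib flip: exp_add)
    moreover have "iexp (p \<bullet> x) * \<eta> p = (iexp (p \<bullet> x) * iexp (- (p \<bullet> z))) * complex_of_real (exp (- \<epsilon> * (norm p)\<^sup>2))" for p
      by (simp only: \<eta>_def mult_ac)
    ultimately have "iexp (p \<bullet> x) * \<eta> p = iexp ((x - z) \<bullet> p) * complex_of_real (exp (- \<epsilon> * (norm p)\<^sup>2))" for p
      by (simp only:)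
    then show ?thesis by (simp only: fourier_gauss_hat[OF e])
  qed
  have mf: "(LINT p|lborel. T n p * \<eta> p) = (LINT x|lborel. f n x * complex_of_real (gauss_hat \<epsilon> (x - z)))" for n
    using fourier_multiplication_formula[OF f \<eta>, of n] by (simp add: Tf \<eta>hat)
  have rhs: "(\<lambda>n. LINT x|lborel. f n x * complex_of_real (gauss_hat \<epsilon> (x - z)))
      \<longlonglongrightarrow> (LINT x|lborel. \<psi> x * complex_of_real (gauss_hat \<epsilon> (x - z)))"
  proof (rule integral_dominated_convergence)
    define C where "C = sqrt (pi / \<epsilon>) ^ DIM(real^2) * exp ((norm z)\<^sup>2 / (4 * \<epsilon>))"
    show "integrable lborel (\<lambda>x. C * (cmod (\<psi> x) * exp (- (1 / (8 * \<epsilon>)) * (norm x)\<^sup>2)))"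
      using e by (intro integrable_mult_right integrable_L2_mult_gaussian \<psi>) auto
    show "AE x in lborel. norm (f n x * complex_of_real (gauss_hat \<epsilon> (x - z)))
        \<le> C * (cmod (\<psi> x) * exp (- (1 / (8 * \<epsilon>)) * (norm x)\<^sup>2))" for n
    proof (rule AE_I2)
      fix x
      have "norm (f n x * complex_of_real (gauss_hat \<epsilon> (x - z))) \<le> cmod (\<psi> x) * gauss_hat \<epsilon> (x - z)"
        using e by (auto simp: f_def norm_mult split: split_indicator)
      also have "\<dots> \<le> cmod (\<psi> x) * (C * exp (- (1 / (8 * \<epsilon>)) * (norm x)\<^sup>2))"
        unfolding C_def by (intro mult_left_mono gauss_hat_le_gaussian[OF e]) auto
      finally show "norm (f n x * complex_of_real (gauss_hat \<epsilon> (x - z)))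
        \<le> C * (cmod (\<psi> x) * exp (- (1 / (8 * \<epsilon>)) * (norm x)\<^sup>2))" by (simp only: mult.left_commute)
    qed
    show "AE x in lborel. (\<lambda>n. f n x * complex_of_real (gauss_hat \<epsilon> (x - z))) \<longlonglongrightarrow> \<psi> x * complex_of_real (gauss_hat \<epsilon> (x - z))"
    proof (intro AE_I2 tendsto_mult tendsto_const)
      fix x :: "real^2"
      obtain N where "norm x \<le> real N" using real_arch_simple by blast
      then have "eventually (\<lambda>n. f n x = \<psi> x) sequentially"
        by (intro eventually_sequentiallyI[of N]) (auto simp: f_def)
      then show "(\<lambda>n. f n x) \<longlonglongrightarrow> \<psi> x" by (rule tendsto_eventually)
    qed
  qed measurable
  have \<phi>\<eta>: "integrable lborel (\<lambda>p. \<phi> p * \<eta> p)"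
  proof (rule Bochner_Integration.integrable_bound)
    have "integrable lborel (\<lambda>p. (cmod (\<phi> p))\<^sup>2)"
      using ft by (simp add: is_fourier_transform_def L2_def integrable_completion)
    then show "integrable lborel (\<lambda>p. cmod (\<phi> p) * exp (- \<epsilon> * (norm p)\<^sup>2))"
      using e by (intro integrable_L2_mult_gaussian) auto
  qed (auto simp: norm_mult n\<eta>)
  have T\<eta>: "integrable lborel (\<lambda>p. T n p * \<eta> p)" for n
  proof (rule Bochner_Integration.integrable_bound[OF integrable_mult_right[OF \<eta>, of "complex_of_real (LINT x|lborel. cmod (f n x))"]])
    have "cmod (T n p) \<le> (LINT x|lborel. cmod (f n x))" for p
      unfolding Tf by (rule order_trans[OF integral_norm_bound]) (simp add: norm_mult)
    then show "AE p in lborel. norm (T n p * \<eta> p) \<le> norm (complex_of_real (LINT x|lborel. cmod (f n x)) * \<eta> p)"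
      by (auto simp: norm_mult intro!: mult_right_mono order_trans[OF _ abs_ge_self])
  qed measurable
  have "(\<lambda>n. (cmod ((LINT p|lborel. \<phi> p * \<eta> p) - (LINT p|lborel. T n p * \<eta> p)))\<^sup>2) \<longlonglongrightarrow> 0"
  proof -
    \<comment> \<open>The factor 1 is the weight in \<open>weighted_Cauchy_Schwarz\<close>.\<close>
    define G where "G = (\<integral>\<^sup>+p. ennreal (1 * (cmod (\<eta> p))\<^sup>2) \<partial>lborel)"
    have "(\<integral>\<^sup>+p. ennreal (exp (- (2 * \<epsilon>) * (norm (p::real^2))\<^sup>2)) \<partial>lborel) < \<infinity>"
      using integrable_gaussian[of "2 * \<epsilon>", where 'a="real^2"] e by (simp add: integrable_iff_bounded)
    moreover have "1 * (cmod (\<eta> p))\<^sup>2 = exp (- (2 * \<epsilon>) * (norm p)\<^sup>2)" for p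
      by (simp add: n\<eta> power2_eq_square flip: exp_add)
    ultimately have G: "G < \<infinity>" by (simp only: G_def)
    have "((\<lambda>R. \<integral>\<^sup>+ p. ennreal ((cmod (\<phi> p - truncated_transform \<psi> R p))\<^sup>2) \<partial>lborel) \<longlongrightarrow> 0) at_top"
      using ft by (simp add: is_fourier_transform_iff_borel)
    from filterlim_compose[OF this filterlim_real_sequentially]
    have "(\<lambda>n. \<integral>\<^sup>+ p. ennreal (1 * (cmod (\<phi> p - T n p))\<^sup>2) \<partial>lborel) \<longlonglongrightarrow> 0"
      by (simp add: T_def)
    then have "(\<lambda>n. G * (\<integral>\<^sup>+ p. ennreal (1 * (cmod (\<phi> p - T n p))\<^sup>2) \<partial>lborel)) \<longlonglongrightarrow> G * 0"
      using G by (intro ennreal_tendsto_cmult) auto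
    then have lim: "(\<lambda>n. G * (\<integral>\<^sup>+ p. ennreal (1 * (cmod (\<phi> p - T n p))\<^sup>2) \<partial>lborel)) \<longlonglongrightarrow> 0"
      by (simp only: mult_zero_right)
    have bound: "ennreal ((cmod ((LINT p|lborel. \<phi> p * \<eta> p) - (LINT p|lborel. T n p * \<eta> p)))\<^sup>2)
       \<le> G * (\<integral>\<^sup>+ p. ennreal (1 * (cmod (\<phi> p - T n p))\<^sup>2) \<partial>lborel)" for n
    proof -
      have "(LINT p|lborel. \<phi> p * \<eta> p) - (LINT p|lborel. T n p * \<eta> p)
          = (LINT p|lborel. complex_of_real 1 * \<eta> p * (\<phi> p - T n p))"
        by (subst Bochner_Integration.integral_diff[symmetric, OF \<phi>\<eta> T\<eta>]) (simp add: algebra_simps)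
      then show ?thesis
        unfolding G_def by (simp only:) (rule weighted_Cauchy_Schwarz; simp)
    qed
    have "(\<lambda>n. ennreal ((cmod ((LINT p|lborel. \<phi> p * \<eta> p) - (LINT p|lborel. T n p * \<eta> p)))\<^sup>2)) \<longlonglongrightarrow> 0"
      by (rule tendsto_sandwich[OF _ _ tendsto_const lim]) (intro always_eventually allI zero_le bound)+
    then show ?thesis by (subst (asm) ennreal_tendsto_0_iff) auto
  qed
  then have "(\<lambda>n. cmod ((LINT p|lborel. \<phi> p * \<eta> p) - (LINT p|lborel. T n p * \<eta> p))) \<longlonglongrightarrow> 0"
    by (simp add: power_tendsto_0_iff)
  then have "(\<lambda>n. (LINT p|lborel. \<phi> p * \<eta> p) - (LINT p|lborel. T n p * \<eta> p)) \<longlonglongrightarrow> 0"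
    by (rule tendsto_norm_zero_cancel)
  from tendsto_diff[OF tendsto_const[of "LINT p|lborel. \<phi> p * \<eta> p"] this]
  have "(\<lambda>n. LINT p|lborel. T n p * \<eta> p) \<longlonglongrightarrow> (LINT p|lborel. \<phi> p * \<eta> p)" by simp
  then have "(LINT p|lborel. \<phi> p * \<eta> p) = (LINT x|lborel. \<psi> x * complex_of_real (gauss_hat \<epsilon> (x - z)))"
    using LIMSEQ_unique[OF _ rhs] by (simp only: mf)
  then show ?thesis by (simp add: \<eta>_def mult.assoc)
qed

section \<open>Nonnegativity of the form\<close>

text \<open>Damping lowers the modulus of \<open>\<phi>\<close> and \<open>gauss_hat\<close> is
  nonnegative, so the undamped double integral bounds all mollified norms at once. The power 4 is
  twice the dimension.\<close>

lemma gaussian_weighted_le_fourier: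
  fixes \<psi> \<phi> :: "real^2 \<Rightarrow> complex"
  assumes [measurable]: "\<psi> \<in> borel_measurable borel" "\<phi> \<in> borel_measurable borel"
    and \<psi>: "integrable lborel (\<lambda>x. (cmod (\<psi> x))\<^sup>2)"
    and ft: "is_fourier_transform 1 \<psi> \<phi>" and a: "a > 0"
  shows "ennreal ((2 * pi) ^ 4) * (\<integral>\<^sup>+x. ennreal (exp (- a * (norm x)\<^sup>2) * (cmod (\<psi> x))\<^sup>2) \<partial>lborel)
        \<le> (\<integral>\<^sup>+p. \<integral>\<^sup>+q. ennreal (cmod (\<phi> p) * cmod (\<phi> q) * gauss_hat a (p - q)) \<partial>lborel \<partial>lborel)"
proof -
  have \<phi>: "integrable lborel (\<lambda>p. (cmod (\<phi> p))\<^sup>2)"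
    using ft by (simp add: is_fourier_transform_def L2_def integrable_completion)
  have "(\<integral>\<^sup>+z. ennreal (exp (- a * (norm z)\<^sup>2)
          * (cmod (LINT x|lborel. \<psi> x * complex_of_real (gauss_hat \<epsilon> (x - z))))\<^sup>2) \<partial>lborel)
      \<le> (\<integral>\<^sup>+p. \<integral>\<^sup>+q. ennreal (cmod (\<phi> p) * cmod (\<phi> q) * gauss_hat a (p - q)) \<partial>lborel \<partial>lborel)"
    if e: "\<epsilon> > 0" for \<epsilon>
  proof -
    define \<kappa> where "\<kappa> p = \<phi> p * complex_of_real (exp (- \<epsilon> * (norm p)\<^sup>2))" for p
    have [measurable]: "\<kappa> \<in> borel_measurable borel" unfolding \<kappa>_def by measurable
    have \<kappa>: "integrable lborel \<kappa>"
      by (rule Bochner_Integration.integrable_bound[OF integrable_L2_mult_gaussian[OF _ \<phi> e]])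
         (auto simp: \<kappa>_def norm_mult)
    have \<kappa>_le: "cmod (\<kappa> p) \<le> cmod (\<phi> p)" for p
      using e by (simp add: \<kappa>_def norm_mult mult_left_le)
    have "(\<integral>\<^sup>+z. ennreal (exp (- a * (norm z)\<^sup>2)
          * (cmod (LINT x|lborel. \<psi> x * complex_of_real (gauss_hat \<epsilon> (x - z))))\<^sup>2) \<partial>lborel)
      = (\<integral>\<^sup>+z. ennreal (exp (- a * (norm z)\<^sup>2)
          * (cmod (LINT p|lborel. \<kappa> p * iexp (- (p \<bullet> z))))\<^sup>2) \<partial>lborel)"
      unfolding \<kappa>_def by (simp only: gaussian_regularized_inversion[OF assms(1,2) \<psi> ft e])
    also have "\<dots> \<le> (\<integral>\<^sup>+p. \<integral>\<^sup>+q. ennreal (cmod (\<kappa> p) * cmod (\<kappa> q) * gauss_hat a (p - q)) \<partial>lborel \<partial>lborel)"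
      by (rule gaussian_weighted_bound[OF \<kappa> a])
    also have "\<dots> \<le> (\<integral>\<^sup>+p. \<integral>\<^sup>+q. ennreal (cmod (\<phi> p) * cmod (\<phi> q) * gauss_hat a (p - q)) \<partial>lborel \<partial>lborel)"
      using a by (intro nn_integral_mono ennreal_leI mult_right_mono mult_mono \<kappa>_le) auto
    finally show ?thesis .
  qed
  from gaussian_weighted_norm_le_mollified[OF assms(1) \<psi> a this]
  show ?thesis by simp
qed

lemma H_half_representation:
  assumes "\<psi> \<in> H_half" and h: "hbar > 0"
  obtains \<psi>' \<phi> where "\<psi>' \<in> borel_measurable borel" "\<phi> \<in> borel_measurable borel"
    "AE x in lebesgue. \<psi> x = \<psi>' x" "integrable lborel (\<lambda>x. (cmod (\<psi>' x))\<^sup>2)"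
    "is_fourier_transform 1 \<psi>' \<phi>"
    "integrable lborel (\<lambda>p. sqrt (1 + (norm p)\<^sup>2) * (cmod (\<phi> p))\<^sup>2)"
    "fourier_transform hbar \<psi> \<in> borel_measurable lebesgue"
    "AE p in lebesgue. fourier_transform hbar \<psi> p = \<phi> (p /\<^sub>R hbar)"
proof -
  from assms obtain \<phi>0 where L2: "\<psi> \<in> L2" and ft0: "is_fourier_transform 1 \<psi> \<phi>0"
    and kin: "integrable lebesgue (\<lambda>p. sqrt (1 + (norm p)\<^sup>2) * (cmod (\<phi>0 p))\<^sup>2)"
    by (auto simp: H_half_def)
  have \<psi>m: "\<psi> \<in> borel_measurable lebesgue" using L2 by (simp add: L2_def)
  have \<phi>0m: "\<phi>0 \<in> borel_measurable lebesgue" using ft0 by (simp add: is_fourier_transform_def L2_def)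
  obtain \<psi>' where \<psi>'b: "\<psi>' \<in> borel_measurable lborel" and "AE x in lborel. \<psi> x = \<psi>' x"
    using completion_ex_borel_measurable_complex[OF \<psi>m] by blast
  then have eq\<psi>: "AE x in lebesgue. \<psi> x = \<psi>' x" by (simp add: AE_completion_iff)
  obtain \<phi> where \<phi>b: "\<phi> \<in> borel_measurable lborel" and "AE x in lborel. \<phi>0 x = \<phi> x"
    using completion_ex_borel_measurable_complex[OF \<phi>0m] by blast
  then have eq\<phi>: "AE x in lebesgue. \<phi>0 x = \<phi> x" by (simp add: AE_completion_iff)
  have [measurable]: "\<psi>' \<in> borel_measurable borel" "\<phi> \<in> borel_measurable borel"
    using \<psi>'b \<phi>b by simp_all
  have \<psi>'m: "\<psi>' \<in> borel_measurable lebesgue" and \<phi>m: "\<phi> \<in> borel_measurable lebesgue"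
    using \<psi>'b \<phi>b by (auto intro: measurable_completion)
  note ft_eq = is_fourier_transform_cong_AE[OF \<psi>m \<psi>'m eq\<psi>]
  have int\<psi>': "integrable lborel (\<lambda>x. (cmod (\<psi>' x))\<^sup>2)"
    using L2_cong_AE[OF L2 \<psi>'m eq\<psi>] by (simp add: L2_def integrable_completion)
  have ft: "is_fourier_transform 1 \<psi>' \<phi>"
    using is_fourier_transform_cong_AE_right[OF ft0 \<phi>m eq\<phi>] by (simp only: ft_eq)
  have "integrable lebesgue (\<lambda>p. sqrt (1 + (norm p)\<^sup>2) * (cmod (\<phi> p))\<^sup>2)"
  proof (rule Bochner_Integration.integrable_cong_AE_imp[OF kin])
    show "(\<lambda>p. sqrt (1 + (norm p)\<^sup>2) * (cmod (\<phi> p))\<^sup>2) \<in> borel_measurable lebesgue"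
      by (intro measurable_completion) measurable
    show "AE p in lebesgue. sqrt (1 + (norm p)\<^sup>2) * (cmod (\<phi>0 p))\<^sup>2 = sqrt (1 + (norm p)\<^sup>2) * (cmod (\<phi> p))\<^sup>2"
      using eq\<phi> by eventually_elim simp
  qed
  then have int\<phi>: "integrable lborel (\<lambda>p. sqrt (1 + (norm p)\<^sup>2) * (cmod (\<phi> p))\<^sup>2)"
    by (subst (asm) integrable_completion) auto
  have fth: "is_fourier_transform hbar \<psi>' (\<lambda>p. \<phi> (p /\<^sub>R hbar))"
    by (rule is_fourier_transform_scale[OF _ _ h ft]) auto
  \<comment> \<open>\<open>ft_eq\<close> rewrites the predicate under \<open>SOME\<close> as well,
    so the dilate of \<open>\<phi>\<close> shows that the choice is a genuine transform.\<close>
  then have "is_fourier_transform hbar \<psi> (fourier_transform hbar \<psi>)"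
    unfolding fourier_transform_def ft_eq by (rule someI[of "is_fourier_transform hbar \<psi>'"])
  then have fts: "is_fourier_transform hbar \<psi>' (fourier_transform hbar \<psi>)" by (simp only: ft_eq)
  show thesis
  proof (rule that[of \<psi>' \<phi>])
    show "fourier_transform hbar \<psi> \<in> borel_measurable lebesgue"
      using fts by (simp add: is_fourier_transform_def L2_def)
    show "AE p in lebesgue. fourier_transform hbar \<psi> p = \<phi> (p /\<^sub>R hbar)"
      by (rule is_fourier_transform_unique[OF _ fts fth]) simp
  qed (use eq\<psi> int\<psi>' ft int\<phi> in auto)
qed

text \<open>The quantity \<open>t\<close>, the integral of
  \<open>norm p * (cmod (\<phi> p))\<^sup>2\<close> at \<open>hbar = 1\<close>, controls both forms:
  the kinetic one from below by dropping the mass, the potential one from above by the Schur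
  test.\<close>

lemma kinetic_and_potential_bounds:
  fixes hbar c m \<beta> :: real
  assumes pos: "hbar > 0" "c > 0" "m > 0" "\<beta> > 0" and \<psi>H: "\<psi> \<in> H_half"
  obtains t where "t \<ge> 0" "integrable lebesgue (kinetic_density hbar c m \<psi>)"
    "integrable lebesgue (potential_density \<beta> \<psi>)"
    "kinetic_form hbar c m \<psi> \<ge> hbar * c / (4 * pi\<^sup>2) * t"
    "potential_form \<beta> \<psi> \<le> 1 / (8 * pi * \<beta>) * t"
proof -
  obtain \<psi>' \<phi> where [measurable]: "\<psi>' \<in> borel_measurable borel" "\<phi> \<in> borel_measurable borel"
    and eq: "AE x in lebesgue. \<psi> x = \<psi>' x" and \<psi>': "integrable lborel (\<lambda>x. (cmod (\<psi>' x))\<^sup>2)"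
    and ft: "is_fourier_transform 1 \<psi>' \<phi>"
    and kin: "integrable lborel (\<lambda>p. sqrt (1 + (norm p)\<^sup>2) * (cmod (\<phi> p))\<^sup>2)"
    and ftm [measurable]: "fourier_transform hbar \<psi> \<in> borel_measurable lebesgue"
    and fteq: "AE p in lebesgue. fourier_transform hbar \<psi> p = \<phi> (p /\<^sub>R hbar)"
    by (rule H_half_representation[OF \<psi>H pos(1)])
  have \<psi>m [measurable]: "\<psi> \<in> borel_measurable lebesgue" using \<psi>H by (simp add: H_half_def L2_def)
  define t where "t = (LINT p|lborel. norm p * (cmod (\<phi> p))\<^sup>2)"
  have t0: "t \<ge> 0" unfolding t_def by (intro integral_nonneg_AE) auto
  have tint: "integrable lborel (\<lambda>p. norm p * (cmod (\<phi> p))\<^sup>2)"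
    by (rule Bochner_Integration.integrable_bound[OF kin])
       (auto simp: abs_mult intro!: mult_right_mono real_le_rsqrt)
  have T: "(\<integral>\<^sup>+p. ennreal (norm p * (cmod (\<phi> p))\<^sup>2) \<partial>lborel) = ennreal t"
    unfolding t_def by (rule nn_integral_eq_integral[OF tint]) auto
  \<comment> \<open>The kinetic density in the variable k = p/hbar. The Jacobian
    \<open>hbar\<^sup>2\<close> cancels against the prefactor of the form and leaves 1/(4
    pi^2).\<close>
  define s where "s k = sqrt (c\<^sup>2 * (norm (hbar *\<^sub>R (k::real^2)))\<^sup>2 + m\<^sup>2 * c^4) * (cmod (\<phi> k))\<^sup>2" for k
  have [measurable]: "s \<in> borel_measurable borel" unfolding s_def by measurable
  have s_ge: "hbar * c * (norm k * (cmod (\<phi> k))\<^sup>2) \<le> s k" for k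
  proof -
    have "hbar * c * norm k \<le> sqrt (c\<^sup>2 * (norm (hbar *\<^sub>R k))\<^sup>2 + m\<^sup>2 * c^4)"
      by (rule real_le_rsqrt) (simp add: power_mult_distrib mult_ac)
    from mult_right_mono[OF this, of "(cmod (\<phi> k))\<^sup>2"] show ?thesis by (simp add: s_def mult.assoc)
  qed
  \<comment> \<open>The condition in \<open>H_half\<close> uses
    \<open>sqrt (1 + (norm p)\<^sup>2)\<close>; this comparison turns it into integrability of the
    kinetic density.\<close>
  have s_le: "s k \<le> (hbar * c + m * c\<^sup>2) * (sqrt (1 + (norm k)\<^sup>2) * (cmod (\<phi> k))\<^sup>2)" for k
  proof -
    have "c\<^sup>2 * (norm (hbar *\<^sub>R k))\<^sup>2 + m\<^sup>2 * c^4 \<le> (hbar * c + m * c\<^sup>2)\<^sup>2 * (1 + (norm k)\<^sup>2)"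
      using pos by (simp add: power_mult_distrib power2_sum algebra_simps power4_eq_xxxx power2_eq_square)
    then have "sqrt (c\<^sup>2 * (norm (hbar *\<^sub>R k))\<^sup>2 + m\<^sup>2 * c^4) \<le> sqrt ((hbar * c + m * c\<^sup>2)\<^sup>2 * (1 + (norm k)\<^sup>2))"
      by (rule real_sqrt_le_mono)
    also have "\<dots> = (hbar * c + m * c\<^sup>2) * sqrt (1 + (norm k)\<^sup>2)"
      using pos by (simp add: real_sqrt_mult)
    finally show ?thesis
      unfolding s_def mult.assoc[symmetric] by (rule mult_right_mono) simp
  qed
  have s0: "s k \<ge> 0" for k by (simp add: s_def)
  have sint: "integrable lborel s"
    by (rule Bochner_Integration.integrable_bound[OF integrable_mult_right[OF kin, of "hbar * c + m * c\<^sup>2"]])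
       (use s0 s_le in \<open>auto intro!: AE_I2 order_trans[OF _ abs_ge_self]\<close>)
  define S where "S = (LINT k|lborel. s k)"
  have S0: "S \<ge> 0" unfolding S_def using s0 by (intro integral_nonneg_AE) auto
  have St: "hbar * c * t \<le> S"
    unfolding S_def t_def using tint sint s_ge
    by (subst integral_mult_right_zero[symmetric]) (intro integral_mono, auto)
  have kd0: "kinetic_density hbar c m \<psi> p \<ge> 0" for p by (simp add: kinetic_density_def)
  have kdm [measurable]: "kinetic_density hbar c m \<psi> \<in> borel_measurable lebesgue"
  proof -
    have [measurable]: "(\<lambda>p::real^2. sqrt (c\<^sup>2 * (norm p)\<^sup>2 + m\<^sup>2 * c^4)) \<in> borel_measurable lebesgue"
      by (intro measurable_completion) measurable
    show ?thesis unfolding kinetic_density_def[abs_def] by measurable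
  qed
  have "(\<integral>\<^sup>+p. ennreal (kinetic_density hbar c m \<psi> p) \<partial>lebesgue) = (\<integral>\<^sup>+p. ennreal (s (p /\<^sub>R hbar)) \<partial>lebesgue)"
  proof (rule nn_integral_cong_AE)
    show "AE p in lebesgue. ennreal (kinetic_density hbar c m \<psi> p) = ennreal (s (p /\<^sub>R hbar))"
      using fteq by eventually_elim (use pos in \<open>simp add: kinetic_density_def s_def\<close>)
  qed
  also have "\<dots> = ennreal (hbar ^ DIM(real^2)) * (\<integral>\<^sup>+p. ennreal (s p) \<partial>lborel)"
    unfolding nn_integral_completion using pos by (intro nn_integral_lborel_scale) auto
  also have "\<dots> = ennreal (hbar\<^sup>2 * S)"
    using nn_integral_eq_integral[OF sint] s0 S0 pos by (simp add: S_def ennreal_mult)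
  finally have kd: "(\<integral>\<^sup>+p. ennreal (kinetic_density hbar c m \<psi> p) \<partial>lebesgue) = ennreal (hbar\<^sup>2 * S)" .
  have kdint: "integrable lebesgue (kinetic_density hbar c m \<psi>)"
    using kd kd0 by (intro integrableI_nonneg) auto
  have "(LINT p|lebesgue. kinetic_density hbar c m \<psi> p) = hbar\<^sup>2 * S"
    using kd kd0 S0 by (subst integral_eq_nn_integral) auto
  then have "kinetic_form hbar c m \<psi> = S / (4 * pi\<^sup>2)"
    using pos by (simp add: kinetic_form_def power_mult_distrib)
  also have "\<dots> \<ge> (hbar * c * t) / (4 * pi\<^sup>2)" using St by (intro divide_right_mono) auto
  finally have kf: "kinetic_form hbar c m \<psi> \<ge> hbar * c / (4 * pi\<^sup>2) * t" by simp

  have bK: "bessel_K 0 x \<ge> 0" for x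
    unfolding bessel_K_def set_lebesgue_integral_def by (intro integral_nonneg_AE) auto
  have pd0: "potential_density \<beta> \<psi> x \<ge> 0" for x by (simp add: potential_density_def bK)
  have pdm [measurable]: "potential_density \<beta> \<psi> \<in> borel_measurable lebesgue"
  proof -
    have [measurable]: "(\<lambda>x::real^2. bessel_K 0 (\<beta> * norm x)) \<in> borel_measurable lebesgue"
      by (intro measurable_completion) measurable
    show ?thesis unfolding potential_density_def[abs_def] by measurable
  qed
  define P where "P = (\<integral>\<^sup>+x. ennreal (potential_density \<beta> \<psi> x) \<partial>lebesgue)"
  have P_eq: "P = (\<integral>\<^sup>+x. ennreal (bessel_K 0 (\<beta> * norm x) * (cmod (\<psi>' x))\<^sup>2) \<partial>lebesgue)"
    unfolding P_def
  proof (rule nn_integral_cong_AE)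
    show "AE x in lebesgue. ennreal (potential_density \<beta> \<psi> x) = ennreal (bessel_K 0 (\<beta> * norm x) * (cmod (\<psi>' x))\<^sup>2)"
      using eq by eventually_elim (simp add: potential_density_def)
  qed
  have "ennreal ((2 * pi) ^ 4) * P \<le> ennreal (2 * pi * (pi\<^sup>2 / \<beta>)) * (\<integral>\<^sup>+p. ennreal (norm p * (cmod (\<phi> p))\<^sup>2) \<partial>lborel)"
    unfolding P_eq nn_integral_completion
  proof (rule bessel_potential_le_of_gaussian[OF _ _ pos(4)])
    fix a :: real assume "a > 0"
    then show "ennreal ((2 * pi) ^ 4) * (\<integral>\<^sup>+x. ennreal (exp (- a * (norm x)\<^sup>2) * (cmod (\<psi>' x))\<^sup>2) \<partial>lborel)
        \<le> (\<integral>\<^sup>+p. \<integral>\<^sup>+q. ennreal (cmod (\<phi> p) * cmod (\<phi> q) * gauss_hat a (p - q)) \<partial>lborel \<partial>lborel)"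
      by (intro gaussian_weighted_le_fourier \<psi>' ft) measurable
  qed measurable
  then have "ennreal ((2 * pi) ^ 4) * P \<le> ennreal (2 * pi * (pi\<^sup>2 / \<beta>)) * ennreal t"
    by (simp only: T)
  then have "ennreal (1 / (2 * pi) ^ 4) * (ennreal ((2 * pi) ^ 4) * P)
     \<le> ennreal (1 / (2 * pi) ^ 4) * (ennreal (2 * pi * (pi\<^sup>2 / \<beta>)) * ennreal t)"
    by (rule mult_left_mono) simp
  also have "ennreal (1 / (2 * pi) ^ 4) * (ennreal ((2 * pi) ^ 4) * P) = P"
    by (subst mult.assoc[symmetric], subst ennreal_mult[symmetric]) auto
  also have "ennreal (1 / (2 * pi) ^ 4) * (ennreal (2 * pi * (pi\<^sup>2 / \<beta>)) * ennreal t) = ennreal (1 / (8 * pi * \<beta>) * t)"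
  proof -
    have "1 / (2 * pi) ^ 4 * (2 * pi * (pi\<^sup>2 / \<beta>) * t) = 1 / (8 * pi * \<beta>) * t"
      using pos by (simp add: field_simps power2_eq_square power4_eq_xxxx)
    moreover have "ennreal (2 * pi * (pi\<^sup>2 / \<beta>)) * ennreal t = ennreal (2 * pi * (pi\<^sup>2 / \<beta>) * t)"
      using t0 by (rule ennreal_mult''[symmetric])
    moreover have "ennreal (1 / (2 * pi) ^ 4) * ennreal (2 * pi * (pi\<^sup>2 / \<beta>) * t)
        = ennreal (1 / (2 * pi) ^ 4 * (2 * pi * (pi\<^sup>2 / \<beta>) * t))"
      using t0 pos by (intro ennreal_mult''[symmetric]) auto
    ultimately show ?thesis by (simp only:)
  qed
  finally have P: "P \<le> ennreal (1 / (8 * pi * \<beta>) * t)" .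
  have pdint: "integrable lebesgue (potential_density \<beta> \<psi>)"
    using P pd0 by (intro integrableI_nonneg) (auto simp: P_def[symmetric] intro: le_less_trans)
  have "ennreal (potential_form \<beta> \<psi>) = P"
    unfolding potential_form_def P_def using nn_integral_eq_integral[OF pdint] pd0 by simp
  with P have "ennreal (potential_form \<beta> \<psi>) \<le> ennreal (1 / (8 * pi * \<beta>) * t)" by (simp only:)
  moreover have "0 \<le> 1 / (8 * pi * \<beta>) * t" using pos t0 by simp
  ultimately have pf: "potential_form \<beta> \<psi> \<le> 1 / (8 * pi * \<beta>) * t"
    by (simp only: ennreal_le_iff)
  show thesis by (rule that[OF t0 kdint pdint kf pf])
qed

text \<open>Integrability belongs to the conclusion because the Bochner integral of a non-integrable
  density is 0 by default; it certifies that both forms are true integrals.\<close>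

theorem mainTheorem2:
  fixes hbar c m \<beta> \<gamma> :: real
  assumes "hbar > 0" and "c > 0" and "m > 0" and "\<beta> > 0" and "\<gamma> \<ge> 0"
    and "\<gamma> \<le> gamma_crit hbar c \<beta>"
  shows "(\<forall>\<psi>\<in>H_half. integrable lebesgue (kinetic_density hbar c m \<psi>) \<and>
                     integrable lebesgue (potential_density \<beta> \<psi>))
       \<and> (\<exists>C. \<forall>\<psi>\<in>H_half. B_FW_form hbar c m \<beta> \<gamma> \<psi> \<ge> - C * (LINT x|lebesgue. (cmod (\<psi> x))\<^sup>2))
       \<and> (\<forall>\<psi>\<in>H_half. B_FW_form hbar c m \<beta> \<gamma> \<psi> \<ge> 0)"
proof -
  have "B_FW_form hbar c m \<beta> \<gamma> \<psi> \<ge> 0" if \<psi>: "\<psi> \<in> H_half" for \<psi>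
  proof -
    obtain t where t: "t \<ge> 0"
      and kin: "kinetic_form hbar c m \<psi> \<ge> hbar * c / (4 * pi\<^sup>2) * t"
      and pot: "potential_form \<beta> \<psi> \<le> 1 / (8 * pi * \<beta>) * t"
      by (rule kinetic_and_potential_bounds[OF assms(1-4) \<psi>])
    have "\<gamma> * potential_form \<beta> \<psi> \<le> \<gamma> * (1 / (8 * pi * \<beta>) * t)"
      using pot assms(5) by (rule mult_left_mono)
    also have "\<dots> \<le> (2 / pi * hbar * c * \<beta>) * (1 / (8 * pi * \<beta>) * t)"
      using assms t gamma_crit_le[of hbar c \<beta>] by (intro mult_right_mono) auto
    \<comment> \<open>At coupling 2 hbar c beta / pi the bounds on the two forms coincide, so the
      difference is nonnegative and \<open>C = 0\<close> serves as the lower bound.\<close>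
    also have "\<dots> = hbar * c / (4 * pi\<^sup>2) * t"
      using assms by (simp add: field_simps power2_eq_square)
    finally show ?thesis using kin by (simp add: B_FW_form_def)
  qed
  moreover have "integrable lebesgue (kinetic_density hbar c m \<psi>) \<and> integrable lebesgue (potential_density \<beta> \<psi>)"
    if "\<psi> \<in> H_half" for \<psi>
    by (rule kinetic_and_potential_bounds[OF assms(1-4) that]) (intro conjI)
  ultimately show ?thesis by (intro conjI exI[of _ 0]) auto
qed

end
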